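(* Let $p\ge 2$ be a prime number and let $1 \to A \to G \to B \to 1$ be a short exact sequence of groups such that: (1) $A$ is residually $p$-nilpotent; (2) $B$ is nilpotent, i.e. $\gamma_s(B)=1$ for some $s\ge2$; (3) there is a natural number $N\ge1$ such that $\Delta_B^N\,\overline{A}\subseteq p\,\overline{A}$, where $\overline{A}=A/\gamma_2(A)$. Then $G$ is residually nilpotent.
   Context: $\gamma_1(G)=G$, $\gamma_{k+1}(G)=[\gamma_k(G),G]$; $G$ is residually nilpotent if $\bigcap_{k\ge1}\gamma_k(G)=1$. The lower $p$-series is $\gamma^{(p)}_1(G)=G$, $\gamma^{(p)}_{k+1}(G)=[G,\gamma^{(p)}_k(G)]\,(\gamma^{(p)}_k(G))^p$, where $H^p$ is the subgroup generated by all $p$-th powers of elements of $H$. A group $G$ is residually $p$-nilpotent if $\bigcap_{k\ge1}\gamma^{(p)}_k(G)=1$. In an extension $1\to A\to G\to B\to 1$, $A$ is regarded as a normal subgroup of $G$ with $G/A\cong B$; conjugation in $G$ induces an action of $B$ on the abelian group $\overline{A}=A/\gamma_2(A)$ (written additively), making it a $\mathbb{Z}[B]$-module. $\Delta_B=\ker(\mathbb{Z}[B]\to\mathbb{Z})$ is the augmentation ideal and $\Delta_B^N$ its $N$-th power. *)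

theory Defs
  imports
    "HOL-Algebra.Generated_Groups"
    "HOL-Algebra.Ideal_Product"
    "HOL-Algebra.IntRing"
    "HOL-Algebra.Module"
    "HOL-Library.Poly_Mapping"
begin

section \<open>Lower central series and lower \<open>p\<close>-series\<close>

definition commutator_subgroup ::
    "('a, 'm) monoid_scheme \<Rightarrow> 'a set \<Rightarrow> 'a set \<Rightarrow> 'a set" where
  "commutator_subgroup G H K =
     generate G (\<Union>h\<in>H. \<Union>k\<in>K. {h \<otimes>\<^bsub>G\<^esub> k \<otimes>\<^bsub>G\<^esub> inv\<^bsub>G\<^esub> h \<otimes>\<^bsub>G\<^esub> inv\<^bsub>G\<^esub> k})"

definition power_subgroup ::
    "('a, 'm) monoid_scheme \<Rightarrow> nat \<Rightarrow> 'a set \<Rightarrow> 'a set" where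
  "power_subgroup G p H = generate G ((\<lambda>x. x [^]\<^bsub>G\<^esub> p) ` H)"

text \<open>Both series are indexed from 1; the value at index 0 is a dummy.\<close>

fun lower_central :: "('a, 'm) monoid_scheme \<Rightarrow> nat \<Rightarrow> 'a set" where
  "lower_central G 0 = carrier G"
| "lower_central G (Suc 0) = carrier G"
| "lower_central G (Suc (Suc k)) =
     commutator_subgroup G (lower_central G (Suc k)) (carrier G)"

fun lower_p_series :: "nat \<Rightarrow> ('a, 'm) monoid_scheme \<Rightarrow> nat \<Rightarrow> 'a set" where
  "lower_p_series p G 0 = carrier G"
| "lower_p_series p G (Suc 0) = carrier G"
| "lower_p_series p G (Suc (Suc k)) =
     commutator_subgroup G (carrier G) (lower_p_series p G (Suc k))
       <#>\<^bsub>G\<^esub> power_subgroup G p (lower_p_series p G (Suc k))"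

definition residually_nilpotent :: "('a, 'm) monoid_scheme \<Rightarrow> bool" where
  "residually_nilpotent G \<longleftrightarrow> (\<Inter>k\<in>{1..}. lower_central G k) = {\<one>\<^bsub>G\<^esub>}"

definition residually_p_nilpotent :: "nat \<Rightarrow> ('a, 'm) monoid_scheme \<Rightarrow> bool" where
  "residually_p_nilpotent p G \<longleftrightarrow> (\<Inter>k\<in>{1..}. lower_p_series p G k) = {\<one>\<^bsub>G\<^esub>}"


section \<open>The integral group ring and its augmentation ideal\<close>

text \<open>
  An element of the group ring is a finitely supported integer-valued function whose
  support lies in the carrier of the group; the product is convolution.
\<close>

definition group_ring :: "('b, 'm) monoid_scheme \<Rightarrow> ('b \<Rightarrow>\<^sub>0 int) ring" where
  "group_ring B =
     \<lparr> carrier = {u. Poly_Mapping.keys u \<subseteq> carrier B},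
       monoid.mult = (\<lambda>u v. \<Sum>x\<in>Poly_Mapping.keys u. \<Sum>y\<in>Poly_Mapping.keys v.
                Poly_Mapping.single (x \<otimes>\<^bsub>B\<^esub> y)
                  (Poly_Mapping.lookup u x * Poly_Mapping.lookup v y)),
       one = Poly_Mapping.single \<one>\<^bsub>B\<^esub> 1,
       zero = 0,
       add = (+) \<rparr>"

definition augmentation :: "('b \<Rightarrow>\<^sub>0 int) \<Rightarrow> int" where
  "augmentation u = (\<Sum>x\<in>Poly_Mapping.keys u. Poly_Mapping.lookup u x)"

definition augmentation_ideal :: "('b, 'm) monoid_scheme \<Rightarrow> ('b \<Rightarrow>\<^sub>0 int) set" where
  "augmentation_ideal B = a_kernel (group_ring B) \<Z> augmentation"

text \<open>The power is taken in the library's monoid of two-sided ideals of the group ring.\<close>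

definition augmentation_power ::
    "('b, 'm) monoid_scheme \<Rightarrow> nat \<Rightarrow> ('b \<Rightarrow>\<^sub>0 int) set" where
  "augmentation_power B N = augmentation_ideal B [^]\<^bsub>ideals_set (group_ring B)\<^esub> N"


section \<open>The module structure on the abelianised kernel of an extension\<close>

definition short_exact ::
    "('a, 'k) monoid_scheme \<Rightarrow> ('a \<Rightarrow> 'g) \<Rightarrow> ('g, 'l) monoid_scheme \<Rightarrow>
     ('g \<Rightarrow> 'b) \<Rightarrow> ('b, 'm) monoid_scheme \<Rightarrow> bool" where
  "short_exact A i G q B \<longleftrightarrow>
     group A \<and> group G \<and> group B \<and> i \<in> mon A G \<and> q \<in> epi G B \<and>
     i ` carrier A = kernel G B q"

text \<open>
  The action of \<open>b\<close> sends the class of \<open>x\<close> to the class of \<open>g x g\<^sup>-\<^sup>1\<close>, for any lift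
  \<open>g\<close> of \<open>b\<close>. For a coset \<open>X\<close> of the second term of the lower central series of \<open>A\<close>, the
  set of all such conjugates, over all lifts \<open>g\<close> and all \<open>x \<in> X\<close>, is a single coset: two
  lifts differ by an element of \<open>A\<close>, and conjugation by elements of \<open>A\<close> preserves every
  such coset. So no lift has to be chosen.
\<close>

definition conj_action ::
    "('a, 'k) monoid_scheme \<Rightarrow> ('a \<Rightarrow> 'g) \<Rightarrow> ('g, 'l) monoid_scheme \<Rightarrow>
     ('g \<Rightarrow> 'b) \<Rightarrow> 'b \<Rightarrow> 'a set \<Rightarrow> 'a set" where
  "conj_action A i G q b X =
     {y \<in> carrier A. \<exists>g\<in>carrier G. \<exists>x\<in>X.
        q g = b \<and> i y = g \<otimes>\<^bsub>G\<^esub> i x \<otimes>\<^bsub>G\<^esub> inv\<^bsub>G\<^esub> g}"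

text \<open>
  The factor group of \<open>A\<close> by its commutator subgroup, written additively. The fields
  \<open>mult\<close> and \<open>one\<close> are only there because the library's module record extends the ring
  record; they carry no meaning for a module. The scalar product of \<open>\<Sum> n\<^sub>b b\<close> and \<open>X\<close> is
  \<open>\<Sum> n\<^sub>b (b X)\<close>, computed in the (multiplicatively written) factor group.
\<close>

definition kernel_abelianization ::
    "('a, 'k) monoid_scheme \<Rightarrow> ('a \<Rightarrow> 'g) \<Rightarrow> ('g, 'l) monoid_scheme \<Rightarrow>
     ('g \<Rightarrow> 'b) \<Rightarrow> ('b \<Rightarrow>\<^sub>0 int, 'a set) module" where
  "kernel_abelianization A i G q =
     (let Q = A Mod lower_central A 2 in
      \<lparr> carrier = carrier Q,
        monoid.mult = undefined,
        one = undefined,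
        zero = \<one>\<^bsub>Q\<^esub>,
        add = monoid.mult Q,
        smult = (\<lambda>u X. finprod Q
                   (\<lambda>b. conj_action A i G q b X [^]\<^bsub>Q\<^esub> Poly_Mapping.lookup u b)
                   (Poly_Mapping.keys u)) \<rparr>)"

definition ideal_smult :: "('r, 'x, 'n) module_scheme \<Rightarrow> 'r set \<Rightarrow> 'x set" where
  "ideal_smult M I =
     generate (add_monoid M) (\<Union>r\<in>I. \<Union>x\<in>carrier M. {r \<odot>\<^bsub>M\<^esub> x})"

definition nat_multiples :: "('x, 'n) ring_scheme \<Rightarrow> nat \<Rightarrow> 'x set" where
  "nat_multiples M p = (\<lambda>x. [p] \<cdot>\<^bsub>M\<^esub> x) ` carrier M"

end

theory Submission
  imports Defs "HOL-Algebra.Zassenhaus"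
begin

text \<open>
  View \<open>A\<close> as a normal subgroup of \<open>G\<close> and let \<open>K\<close> be a term of its lower \<open>p\<close>-series, so that
  \<open>K\<close> contains both a term of the lower central series of \<open>A\<close> and all \<open>p\<^sup>e\<close>-th powers for some
  \<open>e\<close>. The hypothesis on the augmentation ideal says that the \<open>N\<close>-fold commutator
  \<open>[A, G, \<dots>, G]\<close> lies in \<open>A\<^sup>p [A, A]\<close>. Iterating it \<open>e\<close> times on the abelian group
  \<open>A/[A, A]\<close> shows that \<open>G\<close> acts nilpotently on \<open>A/[A, A]K\<close>. As in P. Hall's nilpotency
  criterion, the three subgroups lemma carries this over to all factors of the lower central series
  of \<open>A\<close> modulo \<open>K\<close>, so some \<open>[A, G, \<dots>, G]\<close> lies in \<open>K\<close>. Since a term of the lower central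
  series of \<open>G\<close> lies in \<open>A\<close>, every \<open>K\<close> contains a term of that series, and the \<open>K\<close> intersect
  trivially.
\<close>

section \<open>Commutators of normal subgroups\<close>

context group
begin

text \<open>Together with \<open>m_assoc\<close> and \<open>inv_mult_group\<close> these
  cancellations reduce group words to a normal form, which is how the commutator identities below
  are verified.\<close>

lemma inv_mult_cancel_left [simp]:
  "x \<in> carrier G \<Longrightarrow> y \<in> carrier G \<Longrightarrow> inv x \<otimes> (x \<otimes> y) = y"
  "x \<in> carrier G \<Longrightarrow> y \<in> carrier G \<Longrightarrow> x \<otimes> (inv x \<otimes> y) = y"
  by (simp_all add: m_assoc[symmetric])

abbreviation commutator :: "'a \<Rightarrow> 'a \<Rightarrow> 'a" where
  "commutator x y \<equiv> x \<otimes> y \<otimes> inv x \<otimes> inv y"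

lemma inv_commutator:
  "x \<in> carrier G \<Longrightarrow> y \<in> carrier G \<Longrightarrow> inv (commutator x y) = commutator y x"
  by (simp add: m_assoc inv_mult_group)

text \<open>The Hall-Witt identity for the convention [x, y] = x y x^-1 y^-1: the expanded word
  cancels freely. If two of the factors lie in a normal subgroup, so does the third.\<close>

lemma hall_witt:
  assumes "x \<in> carrier G" "y \<in> carrier G" "z \<in> carrier G"
  shows "(x \<otimes> commutator y (commutator (inv x) z) \<otimes> inv x)
    \<otimes> (z \<otimes> commutator x (commutator (inv z) y) \<otimes> inv z)
    \<otimes> (y \<otimes> commutator z (commutator (inv y) x) \<otimes> inv y) = \<one>"
  using assms by (simp add: m_assoc inv_mult_group)

lemma normal_conj_iff:
  assumes "W \<lhd> G" "x \<in> carrier G" "g \<in> carrier G"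
  shows "g \<otimes> x \<otimes> inv g \<in> W \<longleftrightarrow> x \<in> W"
proof
  assume "g \<otimes> x \<otimes> inv g \<in> W"
  from normal.inv_op_closed1[OF assms(1,3) this] show "x \<in> W"
    using assms by (simp add: m_assoc)
qed (use normal.inv_op_closed2[OF assms(1,3)] in auto)

lemma commutator_subgroup_incl:
  assumes "subgroup W G"
    and "\<And>x y. x \<in> X \<Longrightarrow> y \<in> Y \<Longrightarrow> commutator x y \<in> W"
  shows "commutator_subgroup G X Y \<subseteq> W"
  unfolding commutator_subgroup_def using assms by (intro generate_subgroup_incl) auto

lemma commutator_in_commutator_subgroup:
  "x \<in> X \<Longrightarrow> y \<in> Y \<Longrightarrow> commutator x y \<in> commutator_subgroup G X Y"
  unfolding commutator_subgroup_def by (intro generate.incl) auto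

lemma commutator_subgroup_is_subgroup:
  "X \<subseteq> carrier G \<Longrightarrow> Y \<subseteq> carrier G \<Longrightarrow> subgroup (commutator_subgroup G X Y) G"
  unfolding commutator_subgroup_def by (intro generate_is_subgroup) (auto simp: subset_iff)

lemma commutator_subgroup_mono:
  "X \<subseteq> X' \<Longrightarrow> Y \<subseteq> Y' \<Longrightarrow> commutator_subgroup G X Y \<subseteq> commutator_subgroup G X' Y'"
  unfolding commutator_subgroup_def by (intro mono_generate) blast

lemma normal_subset: "N \<lhd> G \<Longrightarrow> N \<subseteq> carrier G"
  using normal_imp_subgroup subgroup.subset by blast

lemma conj_commutator:
  assumes "x \<in> carrier G" "y \<in> carrier G" "g \<in> carrier G"
  shows "g \<otimes> commutator x y \<otimes> inv g
    = commutator (g \<otimes> x \<otimes> inv g) (g \<otimes> y \<otimes> inv g)"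
  using assms by (simp add: m_assoc inv_mult_group)

lemma commutator_subgroup_normal:
  assumes "X \<lhd> G" "Y \<lhd> G"
  shows "commutator_subgroup G X Y \<lhd> G"
  unfolding commutator_subgroup_def
proof (rule normal_generateI)
  show "(\<Union>h\<in>X. \<Union>k\<in>Y. {commutator h k}) \<subseteq> carrier G"
    using normal_subset[OF assms(1)] normal_subset[OF assms(2)] by blast
next
  fix c g assume "c \<in> (\<Union>h\<in>X. \<Union>k\<in>Y. {commutator h k})" and g: "g \<in> carrier G"
  then obtain x y where xy: "x \<in> X" "y \<in> Y" "c = commutator x y" by blast
  then have "x \<in> carrier G" "y \<in> carrier G"
    using assms normal_subset by blast+
  with xy g have "g \<otimes> c \<otimes> inv g = commutator (g \<otimes> x \<otimes> inv g) (g \<otimes> y \<otimes> inv g)"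
    using conj_commutator by simp
  moreover have "g \<otimes> x \<otimes> inv g \<in> X" "g \<otimes> y \<otimes> inv g \<in> Y"
    using xy g normal.inv_op_closed2 assms by metis+
  ultimately show "g \<otimes> c \<otimes> inv g \<in> (\<Union>h\<in>X. \<Union>k\<in>Y. {commutator h k})" by blast
qed

lemma commutator_subgroup_sym_subset:
  assumes "X \<subseteq> carrier G" "Y \<subseteq> carrier G"
  shows "commutator_subgroup G X Y \<subseteq> commutator_subgroup G Y X"
proof (rule commutator_subgroup_incl)
  show sub: "subgroup (commutator_subgroup G Y X) G"
    using assms commutator_subgroup_is_subgroup by blast
  fix x y assume "x \<in> X" "y \<in> Y"
  then show "commutator x y \<in> commutator_subgroup G Y X"
    using subgroup.m_inv_closed[OF sub commutator_in_commutator_subgroup[of y Y x X]]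
      inv_commutator[of y x] assms by (metis subset_iff)
qed

lemma commutator_subgroup_sym:
  "X \<subseteq> carrier G \<Longrightarrow> Y \<subseteq> carrier G \<Longrightarrow> commutator_subgroup G X Y = commutator_subgroup G Y X"
  using commutator_subgroup_sym_subset by blast

lemma commutator_subgroup_subset_left:
  assumes "X \<lhd> G" "Y \<subseteq> carrier G"
  shows "commutator_subgroup G X Y \<subseteq> X"
proof (rule commutator_subgroup_incl)
  show X: "subgroup X G" using assms(1) by (rule normal_imp_subgroup)
  fix x y assume xy: "x \<in> X" "y \<in> Y"
  then have c: "x \<in> carrier G" "y \<in> carrier G" using assms normal_subset by blast+
  have "y \<otimes> inv x \<otimes> inv y \<in> X"
    using normal.inv_op_closed2[OF assms(1) c(2)] subgroup.m_inv_closed[OF X] xy by blast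
  then show "commutator x y \<in> X"
    using subgroup.m_closed[OF X xy(1)] c by (simp add: m_assoc)
qed

section \<open>Centralizers modulo a normal subgroup and the three subgroups lemma\<close>

text \<open>For normal W and Y inside G this is the preimage of the centralizer of the image of Y in
  G/W. Using preimages keeps the commutator calculus inside G.\<close>

definition centralizer_mod :: "'a set \<Rightarrow> 'a set \<Rightarrow> 'a set" where
  "centralizer_mod W Y = {x \<in> carrier G. \<forall>y\<in>Y. commutator x y \<in> W}"

text \<open>Closure rests on [a^-1, y] = a^-1 [a, y]^-1 a and [ab, y] = a [b, y] a^-1 [a, y];
  normality of W absorbs the conjugations.\<close>

lemma centralizer_mod_subgroup:
  assumes "W \<lhd> G" "Y \<subseteq> carrier G"
  shows "subgroup (centralizer_mod W Y) G"
proof (rule subgroupI)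
  have W: "subgroup W G" using assms(1) by (rule normal_imp_subgroup)
  have "commutator \<one> y \<in> W" if "y \<in> Y" for y
    using that assms subgroup.one_closed[OF W] by auto
  then show "centralizer_mod W Y \<noteq> {}"
    unfolding centralizer_mod_def by blast
  fix a assume a: "a \<in> centralizer_mod W Y"
  show "inv a \<in> centralizer_mod W Y"
  proof -
    have "commutator (inv a) y \<in> W" if y: "y \<in> Y" for y
    proof -
      have c: "a \<in> carrier G" "y \<in> carrier G" using a y assms(2) by (auto simp: centralizer_mod_def)
      have "inv (commutator a y) \<in> W"
        using a y subgroup.m_inv_closed[OF W] by (auto simp: centralizer_mod_def)
      then have "inv a \<otimes> inv (commutator a y) \<otimes> inv (inv a) \<in> W"
        using normal.inv_op_closed2[OF assms(1)] c by blast
      then show ?thesis using c by (simp add: m_assoc inv_mult_group)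
    qed
    with a show ?thesis by (auto simp: centralizer_mod_def)
  qed
  fix b assume b: "b \<in> centralizer_mod W Y"
  show "a \<otimes> b \<in> centralizer_mod W Y"
  proof -
    have "commutator (a \<otimes> b) y \<in> W" if y: "y \<in> Y" for y
    proof -
      have c: "a \<in> carrier G" "b \<in> carrier G" "y \<in> carrier G"
        using a b y assms(2) by (auto simp: centralizer_mod_def)
      have "(a \<otimes> commutator b y \<otimes> inv a) \<otimes> commutator a y \<in> W"
        using a b y subgroup.m_closed[OF W] normal.inv_op_closed2[OF assms(1) c(1)]
        by (auto simp: centralizer_mod_def)
      then show ?thesis using c by (simp add: m_assoc inv_mult_group)
    qed
    with a b show ?thesis by (auto simp: centralizer_mod_def)
  qed
qed (auto simp: centralizer_mod_def)

text \<open>The identity is [g x g^-1, y] = g [x, g^-1 y g] g^-1, where g^-1 y g stays in Y.\<close>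

lemma centralizer_mod_normal:
  assumes "W \<lhd> G" "Y \<lhd> G"
  shows "centralizer_mod W Y \<lhd> G"
proof -
  have Y: "Y \<subseteq> carrier G" using assms(2) by (rule normal_subset)
  have "g \<otimes> x \<otimes> inv g \<in> centralizer_mod W Y"
    if x: "x \<in> centralizer_mod W Y" and g: "g \<in> carrier G" for x g
  proof -
    have xc: "x \<in> carrier G" using x by (simp add: centralizer_mod_def)
    have "commutator (g \<otimes> x \<otimes> inv g) y \<in> W" if y: "y \<in> Y" for y
    proof -
      have yc: "y \<in> carrier G" using y Y by blast
      have "inv g \<otimes> y \<otimes> g \<in> Y" using normal.inv_op_closed1[OF assms(2) g y] .
      then have "g \<otimes> commutator x (inv g \<otimes> y \<otimes> g) \<otimes> inv g \<in> W"
        using x normal.inv_op_closed2[OF assms(1) g] by (auto simp: centralizer_mod_def)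
      then show ?thesis using xc yc g by (simp add: m_assoc inv_mult_group)
    qed
    then show ?thesis using xc g by (auto simp: centralizer_mod_def)
  qed
  then show ?thesis
    using centralizer_mod_subgroup[OF assms(1) Y] by (simp add: normal_inv_iff)
qed

text \<open>Since W is a subgroup, only the generators [x, y] matter. This adjunction is the main
  tool for moving one argument of a commutator to the other side of an inclusion.\<close>

lemma commutator_subgroup_subset_iff:
  assumes "subgroup W G" "X \<subseteq> carrier G"
  shows "commutator_subgroup G X Y \<subseteq> W \<longleftrightarrow> X \<subseteq> centralizer_mod W Y"
  using commutator_in_commutator_subgroup assms
    commutator_subgroup_incl[OF assms(1), of X Y]
  unfolding centralizer_mod_def by blast

lemma subset_centralizer_mod_self:
  assumes "W \<lhd> G" "Y \<subseteq> carrier G" "X \<subseteq> W"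
  shows "X \<subseteq> centralizer_mod W Y"
proof -
  have "W \<subseteq> centralizer_mod W Y"
    using commutator_subgroup_subset_left[OF assms(1,2)]
      commutator_subgroup_subset_iff[OF normal_imp_subgroup[OF assms(1)] normal_subset[OF assms(1)]]
    by blast
  with assms(3) show ?thesis by blast
qed

text \<open>P. Hall's three subgroups lemma modulo W. In the Hall-Witt identity for x, y^-1, z the
  hypotheses put two factors into W, hence also the third. The passage from generators [x, y] to the
  whole subgroup goes through the centralizer of Z modulo W.\<close>

lemma three_subgroups:
  assumes "X \<lhd> G" "Y \<lhd> G" "Z \<lhd> G" "W \<lhd> G"
    and 1: "commutator_subgroup G (commutator_subgroup G X Z) Y \<subseteq> W"
    and 2: "commutator_subgroup G (commutator_subgroup G Y Z) X \<subseteq> W"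
  shows "commutator_subgroup G (commutator_subgroup G X Y) Z \<subseteq> W"
proof -
  note sub = assms(1-3)[THEN normal_subset]
  have W: "subgroup W G" using assms(4) by (rule normal_imp_subgroup)
  have XY: "commutator_subgroup G X Y \<subseteq> carrier G"
    using commutator_subgroup_is_subgroup[OF sub(1,2)] subgroup.subset by blast
  have "commutator x y \<in> centralizer_mod W Z" if x: "x \<in> X" and y: "y \<in> Y" for x y
  proof -
    have xc: "x \<in> carrier G" and yc: "y \<in> carrier G" using x y sub by blast+
    have "commutator (commutator x y) z \<in> W" if z: "z \<in> Z" for z
    proof -
      have zc: "z \<in> carrier G" using z sub by blast
      have c1: "commutator (commutator (inv x) z) (inv y) \<in> W"
      proof -
        have "inv x \<in> X" "inv y \<in> Y"
          using x y assms(1,2)[THEN normal_imp_subgroup] subgroup.m_inv_closed by fast+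
        then show ?thesis
          using 1 z commutator_in_commutator_subgroup by (meson subset_iff)
      qed
      have c2: "commutator (commutator (inv z) (inv y)) x \<in> W"
      proof -
        have "inv z \<in> Z" "inv y \<in> Y"
          using z y assms(2,3)[THEN normal_imp_subgroup] subgroup.m_inv_closed by fast+
        then show ?thesis
          using 2 x commutator_in_commutator_subgroup
          unfolding commutator_subgroup_sym[OF sub(2,3)] by (meson subset_iff)
      qed
      let ?P = "x \<otimes> commutator (inv y) (commutator (inv x) z) \<otimes> inv x"
      let ?Q = "z \<otimes> commutator x (commutator (inv z) (inv y)) \<otimes> inv z"
      let ?R = "inv y \<otimes> commutator z (commutator y x) \<otimes> y"
      have P: "?P \<in> W"
        using normal.inv_op_closed2[OF assms(4) xc subgroup.m_inv_closed[OF W c1]] xc yc zc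
          inv_commutator[of "commutator (inv x) z" "inv y"] by simp
      have Q: "?Q \<in> W"
        using normal.inv_op_closed2[OF assms(4) zc subgroup.m_inv_closed[OF W c2]] xc yc zc
          inv_commutator[of "commutator (inv z) (inv y)" x] by simp
      \<comment> \<open>Substituting y^-1 for y makes [y, x], without inverses inside, appear in the
        last factor.\<close>
      have hw: "?P \<otimes> ?Q \<otimes> ?R = \<one>"
        using hall_witt[of x "inv y" z] xc yc zc by simp
      have "?P \<otimes> ?Q \<in> carrier G" "?R \<in> carrier G"
        using xc yc zc by simp_all
      then have "?R = inv (?P \<otimes> ?Q)"
        using inv_equality[OF inv_comm[OF hw]] by simp
      then have "?R \<in> W"
        using P Q W subgroup.m_inv_closed subgroup.m_closed by metis
      then have "commutator z (commutator y x) \<in> W"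
        using normal_conj_iff[OF assms(4), of "commutator z (commutator y x)" "inv y"] xc yc zc
        by simp
      then have "inv (commutator z (commutator y x)) \<in> W"
        using subgroup.m_inv_closed[OF W] by blast
      then have "commutator (commutator y x) z \<in> W"
        using xc yc zc inv_commutator[of z "commutator y x"] by simp
      \<comment> \<open>Viewed in the centralizer of the single element z modulo W, the step from
        [y, x] to its inverse [x, y] is closure of a subgroup under inverses.\<close>
      then have "commutator y x \<in> centralizer_mod W {z}"
        using xc yc by (simp add: centralizer_mod_def)
      then have "inv (commutator y x) \<in> centralizer_mod W {z}"
        using subgroup.m_inv_closed[OF centralizer_mod_subgroup[OF assms(4), of "{z}"]] zc by simp
      then show ?thesis using xc yc by (simp add: centralizer_mod_def inv_commutator)
    qed
    with xc yc show ?thesis by (simp add: centralizer_mod_def)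
  qed
  then have "commutator_subgroup G X Y \<subseteq> centralizer_mod W Z"
    by (intro commutator_subgroup_incl centralizer_mod_subgroup assms sub)
  then show ?thesis using commutator_subgroup_subset_iff[OF W XY] by blast
qed

section \<open>Iterated commutators with G and the upper central series modulo W\<close>

primrec iterated_commutator :: "'a set \<Rightarrow> nat \<Rightarrow> 'a set" where
  "iterated_commutator X 0 = X"
| "iterated_commutator X (Suc n) = commutator_subgroup G (iterated_commutator X n) (carrier G)"

lemma iterated_commutator_normal: "X \<lhd> G \<Longrightarrow> iterated_commutator X n \<lhd> G"
  by (induction n) (auto intro: commutator_subgroup_normal normal_self)

lemma iterated_commutator_add:
  "iterated_commutator X (m + n) = iterated_commutator (iterated_commutator X m) n"
  by (induction n) auto

lemma iterated_commutator_mono: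
  "X \<subseteq> Y \<Longrightarrow> iterated_commutator X n \<subseteq> iterated_commutator Y n"
  by (induction n) (simp_all add: commutator_subgroup_mono)

lemma iterated_commutator_subset: "X \<lhd> G \<Longrightarrow> iterated_commutator X n \<subseteq> X"
proof (induction n)
  case (Suc n)
  then show ?case
    using commutator_subgroup_subset_left[OF iterated_commutator_normal[OF Suc.prems], of "carrier G" n]
    by auto
qed simp

lemma iterated_commutator_antimono:
  "X \<lhd> G \<Longrightarrow> m \<le> n \<Longrightarrow> iterated_commutator X n \<subseteq> iterated_commutator X m"
  using iterated_commutator_add[of X m "n - m"]
    iterated_commutator_subset[OF iterated_commutator_normal] by auto

text \<open>For normal W this is the preimage of the n-th term of the upper central series of G/W,
  counted from the trivial subgroup at 0.\<close>

primrec upper_central_mod :: "'a set \<Rightarrow> nat \<Rightarrow> 'a set" where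
  "upper_central_mod W 0 = W"
| "upper_central_mod W (Suc n) = centralizer_mod (upper_central_mod W n) (carrier G)"

lemma upper_central_mod_normal: "W \<lhd> G \<Longrightarrow> upper_central_mod W n \<lhd> G"
  by (induction n) (auto intro: centralizer_mod_normal normal_self)

lemma upper_central_mod_supset: "W \<lhd> G \<Longrightarrow> W \<subseteq> upper_central_mod W n"
proof (induction n)
  case (Suc n)
  then show ?case
    using subset_centralizer_mod_self[OF upper_central_mod_normal, of W "carrier G" W n] by simp
qed simp

text \<open>The adjunction for a single commutator, applied n times. Each application removes the
  outermost commutator and replaces W by a centralizer, so W has to vary in the induction.\<close>

lemma iterated_commutator_subset_iff:
  assumes "X \<lhd> G" "W \<lhd> G"
  shows "iterated_commutator X n \<subseteq> W \<longleftrightarrow> X \<subseteq> upper_central_mod W n"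
  using assms(2)
proof (induction n arbitrary: W)
  case (Suc n)
  have "iterated_commutator X (Suc n) \<subseteq> W
    \<longleftrightarrow> iterated_commutator X n \<subseteq> centralizer_mod W (carrier G)"
    using commutator_subgroup_subset_iff[OF normal_imp_subgroup[OF Suc.prems]
      normal_subset[OF iterated_commutator_normal[OF assms(1)]]] by simp
  also have "\<dots> \<longleftrightarrow> X \<subseteq> upper_central_mod (centralizer_mod W (carrier G)) n"
    using Suc.IH centralizer_mod_normal[OF Suc.prems normal_self] by blast
  \<comment> \<open>The induction places the new centralizer innermost and the recursion places it
    outermost; both give the same iterate.\<close>
  also have "upper_central_mod (centralizer_mod W (carrier G)) n = upper_central_mod W (Suc n)"
    by (induction n) auto
  finally show ?case .
qed simp

text \<open>A Leibniz rule: by the three subgroups lemma, commutation with G acts on [X, Y] like a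
  derivation. The subgroup W stands for any normal subgroup containing all terms of total order n,
  so that no product of subgroups is formed.\<close>

lemma iterated_commutator_commutator_subgroup:
  assumes "X \<lhd> G" "Y \<lhd> G" "W \<lhd> G"
    and "\<And>i j. i + j = n \<Longrightarrow>
      commutator_subgroup G (iterated_commutator X i) (iterated_commutator Y j) \<subseteq> W"
  shows "iterated_commutator (commutator_subgroup G X Y) n \<subseteq> W"
  using assms(3,4)
proof (induction n arbitrary: W)
  case 0
  then show ?case using 0(2)[of 0 0] by simp
next
  case (Suc n)
  let ?Z = "centralizer_mod W (carrier G)"
  have "commutator_subgroup G (iterated_commutator X i) (iterated_commutator Y j) \<subseteq> ?Z"
    if "i + j = n" for i j
  proof -
    let ?X = "iterated_commutator X i" and ?Y = "iterated_commutator Y j"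
    have X: "?X \<lhd> G" and Y: "?Y \<lhd> G" using assms iterated_commutator_normal by blast+
    \<comment> \<open>The two hypotheses of the three subgroups lemma are the pairs (i + 1, j) and
      (i, j + 1), both of total order n + 1.\<close>
    have a: "commutator_subgroup G (commutator_subgroup G ?X (carrier G)) ?Y \<subseteq> W"
      using Suc.prems(2)[of "Suc i" j] that by simp
    have "commutator_subgroup G ?X (commutator_subgroup G ?Y (carrier G)) \<subseteq> W"
      using Suc.prems(2)[of i "Suc j"] that by simp
    then have b: "commutator_subgroup G (commutator_subgroup G ?Y (carrier G)) ?X \<subseteq> W"
      using commutator_subgroup_sym normal_subset[OF X]
        normal_subset[OF commutator_subgroup_normal[OF Y normal_self]] by metis
    show ?thesis
      using three_subgroups[OF X Y normal_self Suc.prems(1) a b]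
        commutator_subgroup_subset_iff[OF normal_imp_subgroup[OF Suc.prems(1)]
          normal_subset[OF commutator_subgroup_normal[OF X Y]]] by blast
  qed
  then have "iterated_commutator (commutator_subgroup G X Y) n \<subseteq> ?Z"
    using Suc.IH centralizer_mod_normal[OF Suc.prems(1) normal_self] by blast
  then show ?case
    using commutator_subgroup_subset_iff[OF normal_imp_subgroup[OF Suc.prems(1)]
      normal_subset[OF iterated_commutator_normal[OF commutator_subgroup_normal[OF assms(1,2)]]]]
    by simp
qed

section \<open>P. Hall's argument along the lower central series of N\<close>

text \<open>Indexed from 0, unlike \<open>lower_central\<close>.\<close>

primrec rel_lower_central :: "'a set \<Rightarrow> nat \<Rightarrow> 'a set" where
  "rel_lower_central N 0 = N"
| "rel_lower_central N (Suc k) = commutator_subgroup G (rel_lower_central N k) N"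

lemma rel_lower_central_normal: "N \<lhd> G \<Longrightarrow> rel_lower_central N k \<lhd> G"
  by (induction k) (auto intro: commutator_subgroup_normal)

text \<open>Hall's argument: the factors of the lower central series of \<open>N\<close> are generated by
  commutators, so a nilpotent action on \<open>N/[N,N]\<close> propagates to all of them.\<close>

lemma rel_lower_central_nilpotent_action:
  assumes N: "N \<lhd> G" and K: "K \<lhd> G"
    and m: "\<And>W. W \<lhd> G \<Longrightarrow> commutator_subgroup G N N \<subseteq> W \<Longrightarrow> K \<subseteq> W
      \<Longrightarrow> iterated_commutator N m \<subseteq> W"
  shows "\<exists>n. \<forall>W. W \<lhd> G \<longrightarrow> rel_lower_central N (Suc k) \<subseteq> W \<longrightarrow> K \<subseteq> W
      \<longrightarrow> iterated_commutator (rel_lower_central N k) n \<subseteq> W"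
proof (induction k)
  case 0
  then show ?case using m by auto
next
  case (Suc k)
  let ?L = "rel_lower_central N"
  note L = rel_lower_central_normal[OF N]
  obtain n where n: "\<And>W. W \<lhd> G \<Longrightarrow> ?L (Suc k) \<subseteq> W \<Longrightarrow> K \<subseteq> W
      \<Longrightarrow> iterated_commutator (?L k) n \<subseteq> W"
    using Suc by blast
  \<comment> \<open>If i + j = n + m, then i \<ge> n or j \<ge> m, so every term of the Leibniz rule
    is covered by one of the inclusions \<open>1\<close> and \<open>2\<close> below.\<close>
  have "iterated_commutator (?L (Suc k)) (n + m) \<subseteq> W"
    if W: "W \<lhd> G" and LW: "?L (Suc (Suc k)) \<subseteq> W" and KW: "K \<subseteq> W" for W
  proof -
    note W_sub = normal_imp_subgroup[OF W]
    \<comment> \<open>The induction hypothesis is applied to the centralizer of N modulo W; the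
      quantifier over W exists for such substitutions.\<close>
    have "?L (Suc k) \<subseteq> centralizer_mod W N"
      using LW commutator_subgroup_subset_iff[OF W_sub normal_subset[OF L[of "Suc k"]]] by simp
    moreover have "K \<subseteq> centralizer_mod W N"
      using subset_centralizer_mod_self[OF W normal_subset[OF N] KW] .
    ultimately have "iterated_commutator (?L k) n \<subseteq> centralizer_mod W N"
      by (intro n centralizer_mod_normal W N)
    then have 1: "commutator_subgroup G (iterated_commutator (?L k) n) N \<subseteq> W"
      using commutator_subgroup_subset_iff[OF W_sub
          normal_subset[OF iterated_commutator_normal[OF L]]] by blast
    \<comment> \<open>Both hypotheses of the three subgroups lemma reduce to [[L, N], N] \<subseteq>
      W for L = \<open>?L k\<close>. The result puts [N, N] into the centralizer of L modulo W, so
      that \<open>m\<close> applies to this centralizer.\<close>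
    have "commutator_subgroup G (commutator_subgroup G N N) (?L k) \<subseteq> W"
      using LW commutator_subgroup_sym[OF normal_subset[OF N] normal_subset[OF L[of k]]]
      by (intro three_subgroups[OF N N L W]) simp_all
    then have "commutator_subgroup G N N \<subseteq> centralizer_mod W (?L k)"
      using commutator_subgroup_subset_iff[OF W_sub
        normal_subset[OF commutator_subgroup_normal[OF N N]]] by blast
    moreover have "K \<subseteq> centralizer_mod W (?L k)"
      using subset_centralizer_mod_self[OF W normal_subset[OF L] KW] .
    ultimately have "iterated_commutator N m \<subseteq> centralizer_mod W (?L k)"
      by (intro m centralizer_mod_normal W L)
    then have "commutator_subgroup G (iterated_commutator N m) (?L k) \<subseteq> W"
      using commutator_subgroup_subset_iff[OF W_sub
          normal_subset[OF iterated_commutator_normal[OF N]]] by blast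
    then have 2: "commutator_subgroup G (?L k) (iterated_commutator N m) \<subseteq> W"
      using commutator_subgroup_sym[OF normal_subset[OF L]
          normal_subset[OF iterated_commutator_normal[OF N]]] by metis
    have "commutator_subgroup G (iterated_commutator (?L k) i) (iterated_commutator N j) \<subseteq> W"
      if ij: "i + j = n + m" for i j
    proof (cases "n \<le> i")
      case True
      then show ?thesis
        by (intro order_trans[OF commutator_subgroup_mono 1] iterated_commutator_antimono L
            iterated_commutator_subset N)
    next
      case False
      with ij have "m \<le> j" by simp
      then show ?thesis
        by (intro order_trans[OF commutator_subgroup_mono 2] iterated_commutator_antimono N
            iterated_commutator_subset L)
    qed
    then show ?thesis
      using iterated_commutator_commutator_subgroup[OF L N W] by simp
  qed
  then show ?case by blast
qed

text \<open>The nilpotent actions on the successive factors are composed: [N, G, ..., G] is pushed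
  down the lower central series of N modulo K, one term at a time, until that series lies in K.
  Taking W = K then gives the claim.\<close>

lemma iterated_commutator_subset_of_rel_lower_central:
  assumes N: "N \<lhd> G" and K: "K \<lhd> G"
    and m: "\<And>W. W \<lhd> G \<Longrightarrow> commutator_subgroup G N N \<subseteq> W \<Longrightarrow> K \<subseteq> W
      \<Longrightarrow> iterated_commutator N m \<subseteq> W"
    and c: "rel_lower_central N c \<subseteq> K"
  shows "\<exists>n. iterated_commutator N n \<subseteq> K"
proof -
  have "\<exists>n. \<forall>W. W \<lhd> G \<longrightarrow> rel_lower_central N k \<subseteq> W \<longrightarrow> K \<subseteq> W
      \<longrightarrow> iterated_commutator N n \<subseteq> W" for k
  proof (induction k)
    case 0
    then show ?case by (intro exI[of _ 0]) simp
  next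
    case (Suc k)
    then obtain n where n: "\<And>W. W \<lhd> G \<Longrightarrow> rel_lower_central N k \<subseteq> W \<Longrightarrow> K \<subseteq> W
      \<Longrightarrow> iterated_commutator N n \<subseteq> W" by blast
    obtain n' where n': "\<And>W. W \<lhd> G \<Longrightarrow> rel_lower_central N (Suc k) \<subseteq> W \<Longrightarrow> K \<subseteq> W
      \<Longrightarrow> iterated_commutator (rel_lower_central N k) n' \<subseteq> W"
      using rel_lower_central_nilpotent_action[OF N K m] by blast
    have "iterated_commutator N (n + n') \<subseteq> W"
      if W: "W \<lhd> G" "rel_lower_central N (Suc k) \<subseteq> W" "K \<subseteq> W" for W
    proof -
      \<comment> \<open>The term with index k is killed modulo W by n' commutators, so it lies in
        the n'-th upper central term modulo W, and the induction hypothesis applies to that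
        term.\<close>
      have "iterated_commutator N n \<subseteq> upper_central_mod W n'"
        using n'[OF W] W(1) order_trans[OF W(3) upper_central_mod_supset[OF W(1)]]
        by (intro n upper_central_mod_normal)
          (simp_all add: iterated_commutator_subset_iff[OF rel_lower_central_normal[OF N] W(1)])
      then show ?thesis
        using iterated_commutator_subset_iff[OF iterated_commutator_normal[OF N] W(1)]
        by (simp add: iterated_commutator_add)
    qed
    then show ?case by blast
  qed
  from this[of c] obtain n where "\<forall>W. W \<lhd> G \<longrightarrow> rel_lower_central N c \<subseteq> W \<longrightarrow> K \<subseteq> W
      \<longrightarrow> iterated_commutator N n \<subseteq> W" ..
  with c K have "iterated_commutator N n \<subseteq> K" by simp
  then show ?thesis ..
qed

end

section \<open>Powers and the lower \<open>p\<close>-series\<close>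

lemma (in group) conj_pow:
  fixes n :: nat
  assumes "x \<in> carrier G" "g \<in> carrier G"
  shows "(g \<otimes> x \<otimes> inv g) [^] n = g \<otimes> x [^] n \<otimes> inv g"
  using assms by (induction n) (simp_all add: m_assoc)

lemma (in group) power_subgroup_normal:
  assumes "X \<lhd> G"
  shows "power_subgroup G p X \<lhd> G"
  unfolding power_subgroup_def
proof (rule normal_generateI)
  show "(\<lambda>x. x [^] p) ` X \<subseteq> carrier G" using normal_subset[OF assms] by auto
  fix y g assume "y \<in> (\<lambda>x. x [^] p) ` X" and g: "g \<in> carrier G"
  then obtain x where x: "x \<in> X" "y = x [^] p" by blast
  then have "g \<otimes> y \<otimes> inv g = (g \<otimes> x \<otimes> inv g) [^] p"
    using normal_subset[OF assms] g by (auto simp: conj_pow)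
  then show "g \<otimes> y \<otimes> inv g \<in> (\<lambda>x. x [^] p) ` X"
    using normal.inv_op_closed2[OF assms g x(1)] by blast
qed

lemma (in group) set_mult_normal:
  assumes "X \<lhd> G" "Y \<lhd> G"
  shows "X <#> Y \<lhd> G"
proof -
  have "g \<otimes> z \<otimes> inv g \<in> X <#> Y" if z: "z \<in> X <#> Y" and g: "g \<in> carrier G" for z g
  proof -
    obtain x y where xy: "x \<in> X" "y \<in> Y" "z = x \<otimes> y" using z by (auto simp: set_mult_def)
    then have "x \<in> carrier G" "y \<in> carrier G" using assms normal_subset by blast+
    with xy g have "g \<otimes> z \<otimes> inv g = (g \<otimes> x \<otimes> inv g) \<otimes> (g \<otimes> y \<otimes> inv g)"
      by (simp add: m_assoc)
    moreover have "g \<otimes> x \<otimes> inv g \<in> X" "g \<otimes> y \<otimes> inv g \<in> Y"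
      using xy g normal.inv_op_closed2 assms by metis+
    ultimately show ?thesis by (auto simp: set_mult_def)
  qed
  then show ?thesis
    using mult_norm_subgroup[OF assms(1) normal_imp_subgroup[OF assms(2)]] normal_inv_iff by blast
qed

lemma (in group) subset_set_mult:
  assumes "subgroup X G" "subgroup Y G"
  shows "X \<subseteq> X <#> Y" "Y \<subseteq> X <#> Y"
  using subgroup.one_closed[OF assms(1)] subgroup.one_closed[OF assms(2)]
    subgroup.subset[OF assms(1)] subgroup.subset[OF assms(2)]
  unfolding set_mult_def by (force, force)

lemma (in group) lower_p_series_normal: "lower_p_series p G k \<lhd> G"
proof (cases k)
  case (Suc n)
  have "lower_p_series p G (Suc n) \<lhd> G"
    by (induction n)
      (simp_all add: normal_self set_mult_normal commutator_subgroup_normal power_subgroup_normal)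
  then show ?thesis using Suc by simp
qed (simp add: normal_self)

section \<open>Images of the lower p-series under homomorphisms\<close>

lemma (in group_hom) image_commutator_subgroup:
  assumes "X \<subseteq> carrier G" "Y \<subseteq> carrier G"
  shows "h ` commutator_subgroup G X Y = commutator_subgroup H (h ` X) (h ` Y)"
proof -
  have sub: "(\<Union>x\<in>X. \<Union>y\<in>Y. {G.commutator x y}) \<subseteq> carrier G"
    using assms by (auto simp: subset_iff)
  have "h ` (\<Union>x\<in>X. \<Union>y\<in>Y. {G.commutator x y})
      = (\<Union>x\<in>X. \<Union>y\<in>Y. {H.commutator (h x) (h y)})"
    unfolding image_UN using assms by (intro SUP_cong refl) (auto simp: subset_iff)
  then show ?thesis
    unfolding commutator_subgroup_def using generate_img[OF sub] by simp
qed

lemma (in group_hom) image_power_subgroup: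
  assumes "X \<subseteq> carrier G"
  shows "h ` power_subgroup G p X = power_subgroup H p (h ` X)"
proof -
  have sub: "(\<lambda>x. x [^]\<^bsub>G\<^esub> p) ` X \<subseteq> carrier G"
    using assms by auto
  have "h ` (\<lambda>x. x [^]\<^bsub>G\<^esub> p) ` X = (\<lambda>x. x [^]\<^bsub>H\<^esub> p) ` h ` X"
    unfolding image_image using assms by (intro image_cong refl) (auto simp: hom_nat_pow)
  then show ?thesis
    unfolding power_subgroup_def using generate_img[OF sub] by simp
qed

text \<open>Images commute with commutator subgroups, power subgroups and products, and these
  constructions preserve normality in H. This plays the role of the terms being characteristic in
  the kernel.\<close>

lemma (in group_hom) image_lower_p_series_normal:
  assumes "h ` carrier G \<lhd> H"
  shows "h ` lower_p_series p G k \<lhd> H"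
proof (cases k)
  case (Suc n)
  have "h ` lower_p_series p G (Suc n) \<lhd> H"
  proof (induction n)
    case (Suc n)
    let ?P = "lower_p_series p G (Suc n)"
    have P: "?P \<lhd> G" by (rule G.lower_p_series_normal)
    note c = G.normal_subset[OF P]
    have "h ` lower_p_series p G (Suc (Suc n))
        = commutator_subgroup H (h ` carrier G) (h ` ?P) <#>\<^bsub>H\<^esub> power_subgroup H p (h ` ?P)"
      using set_mult_hom[OF homh G.normal_subset[OF G.commutator_subgroup_normal[OF G.normal_self P]]
        G.normal_subset[OF G.power_subgroup_normal[OF P]]] c
      by (simp add: image_commutator_subgroup image_power_subgroup)
    then show ?case
      using assms Suc
      by (simp add: H.set_mult_normal H.commutator_subgroup_normal H.power_subgroup_normal)
  qed (use assms in simp)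
  then show ?thesis using Suc by simp
qed (use assms in simp)

lemma (in group) commutator_power_subset_lower_p_series:
  "commutator_subgroup G (carrier G) (lower_p_series p G (Suc k)) \<subseteq> lower_p_series p G (Suc (Suc k))"
  "power_subgroup G p (lower_p_series p G (Suc k)) \<subseteq> lower_p_series p G (Suc (Suc k))"
  using subset_set_mult[of "commutator_subgroup G (carrier G) (lower_p_series p G (Suc k))"
      "power_subgroup G p (lower_p_series p G (Suc k))"]
    normal_imp_subgroup[OF commutator_subgroup_normal[OF normal_self lower_p_series_normal]]
    normal_imp_subgroup[OF power_subgroup_normal[OF lower_p_series_normal]]
  by simp_all

text \<open>Each step of the series absorbs one further p-th power. As the series starts at 1, the
  exponent p^k belongs to index k + 1.\<close>

lemma (in group) pow_in_lower_p_series: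
  "x \<in> carrier G \<Longrightarrow> x [^] (p ^ k) \<in> lower_p_series p G (Suc k)"
proof (induction k)
  case 0 then show ?case by (simp add: nat_pow_def)
next
  case (Suc k)
  then have "(x [^] (p ^ k)) [^] p \<in> power_subgroup G p (lower_p_series p G (Suc k))"
    unfolding power_subgroup_def by (intro generate.incl) blast
  then have "(x [^] (p ^ k)) [^] p \<in> lower_p_series p G (Suc (Suc k))"
    using commutator_power_subset_lower_p_series(2) by blast
  then show ?case using Suc.prems by (simp add: nat_pow_pow mult.commute del: lower_p_series.simps)
qed

text \<open>Commutators with the whole group form one of the two factors in each step of the lower
  p-series. Hence the quotients by its terms are nilpotent.\<close>

lemma (in group_hom) rel_lower_central_subset_image_lower_p_series:
  "H.rel_lower_central (h ` carrier G) k \<subseteq> h ` lower_p_series p G (Suc k)"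
proof (induction k)
  case (Suc k)
  let ?P = "lower_p_series p G (Suc k)"
  have P: "?P \<subseteq> carrier G" using G.lower_p_series_normal G.normal_subset by blast
  have "H.rel_lower_central (h ` carrier G) (Suc k)
      \<subseteq> commutator_subgroup H (h ` ?P) (h ` carrier G)"
    using Suc H.commutator_subgroup_mono by simp
  also have "\<dots> = h ` commutator_subgroup G (carrier G) ?P"
    using image_commutator_subgroup[OF P order_refl] G.commutator_subgroup_sym[OF P order_refl]
    by simp
  also have "\<dots> \<subseteq> h ` lower_p_series p G (Suc (Suc k))"
    using G.commutator_power_subset_lower_p_series(1) by (rule image_mono)
  finally show ?case .
qed simp

lemma (in group) iterated_commutator_carrier:
  "iterated_commutator (carrier G) n = lower_central G (Suc n)"
  by (induction n) auto

section \<open>Powers inside iterated commutators\<close>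

text \<open>Since \<open>h\<close> makes \<open>X\<close> commutative, \<open>[x\<^sup>m, g] = [x, g]\<^sup>m\<close> holds after applying \<open>h\<close>.\<close>

lemma (in group_hom) commutator_subgroup_powers:
  fixes m :: nat
  assumes X: "X \<lhd> G"
    and comm: "\<And>x y. x \<in> X \<Longrightarrow> y \<in> X \<Longrightarrow> h x \<otimes>\<^bsub>H\<^esub> h y = h y \<otimes>\<^bsub>H\<^esub> h x"
    and Y: "Y \<subseteq> {y \<in> carrier G. \<exists>x\<in>X. h y = h x [^]\<^bsub>H\<^esub> m}"
  shows "commutator_subgroup G Y (carrier G)
    \<subseteq> {y \<in> carrier G. \<exists>x\<in>commutator_subgroup G X (carrier G). h y = h x [^]\<^bsub>H\<^esub> m}"
    (is "_ \<subseteq> ?S")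
proof (rule G.commutator_subgroup_incl)
  let ?C = "commutator_subgroup G X (carrier G)"
  have C: "subgroup ?C G"
    using G.commutator_subgroup_normal[OF X G.normal_self] normal_imp_subgroup by blast
  have CX: "?C \<subseteq> X" by (rule G.commutator_subgroup_subset_left[OF X order_refl])
  have Xc: "X \<subseteq> carrier G" by (rule G.normal_subset[OF X])
  show "subgroup ?S G"
  proof (rule G.subgroupI)
    show "?S \<noteq> {}"
      using subgroup.one_closed[OF C] by (auto intro!: exI[of _ "\<one>\<^bsub>G\<^esub>"] bexI[of _ "\<one>\<^bsub>G\<^esub>"])
    fix a assume "a \<in> ?S"
    then obtain x where a: "a \<in> carrier G" "x \<in> ?C" "h a = h x [^]\<^bsub>H\<^esub> m" by blast
    moreover have "x \<in> carrier G" using a CX Xc by blast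
    ultimately show "inv\<^bsub>G\<^esub> a \<in> ?S"
      using subgroup.m_inv_closed[OF C a(2)]
      by (auto intro!: bexI[of _ "inv\<^bsub>G\<^esub> x"] simp: H.nat_pow_inv)
    fix b assume "b \<in> ?S"
    then obtain y where b: "b \<in> carrier G" "y \<in> ?C" "h b = h y [^]\<^bsub>H\<^esub> m" by blast
    \<comment> \<open>Both elements lie in [X, G] \<subseteq> X, so their images commute and their
      m-th powers multiply to the m-th power of the product.\<close>
    have "x \<in> X" "y \<in> X" "x \<in> carrier G" "y \<in> carrier G" using a b CX Xc by blast+
    then have "h (a \<otimes>\<^bsub>G\<^esub> b) = h (x \<otimes>\<^bsub>G\<^esub> y) [^]\<^bsub>H\<^esub> m"
      using a b comm by (simp add: H.pow_mult_distrib)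
    then show "a \<otimes>\<^bsub>G\<^esub> b \<in> ?S" using a b subgroup.m_closed[OF C] by blast
  qed auto
  fix y g assume "y \<in> Y" and g: "g \<in> carrier G"
  then obtain x where y: "y \<in> carrier G" "x \<in> X" "h y = h x [^]\<^bsub>H\<^esub> m" using Y by blast
  let ?x = "g \<otimes>\<^bsub>G\<^esub> x \<otimes>\<^bsub>G\<^esub> inv\<^bsub>G\<^esub> g"
  have x: "x \<in> carrier G" using y Xc by blast
  \<comment> \<open>Since [y, g] = y (g y g^-1)^-1, its image is a product of m-th powers of images
    of two elements of X, namely x and the inverse of its conjugate. These images commute.\<close>
  have x': "inv\<^bsub>G\<^esub> ?x \<in> X"
    using normal.inv_op_closed2[OF X g y(2)] subgroup.m_inv_closed[OF normal_imp_subgroup[OF X]]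
    by blast
  have "h (G.commutator y g) = h y \<otimes>\<^bsub>H\<^esub> inv\<^bsub>H\<^esub> (h g \<otimes>\<^bsub>H\<^esub> h y \<otimes>\<^bsub>H\<^esub> inv\<^bsub>H\<^esub> h g)"
    using x y g by (simp add: H.m_assoc H.inv_mult_group)
  also have "\<dots> = h x [^]\<^bsub>H\<^esub> m \<otimes>\<^bsub>H\<^esub> h (inv\<^bsub>G\<^esub> ?x) [^]\<^bsub>H\<^esub> m"
    using x y g by (simp add: H.conj_pow H.nat_pow_inv)
  also have "\<dots> = (h x \<otimes>\<^bsub>H\<^esub> h (inv\<^bsub>G\<^esub> ?x)) [^]\<^bsub>H\<^esub> m"
    using x g by (intro H.pow_mult_distrib[symmetric] comm y x') auto
  also have "h x \<otimes>\<^bsub>H\<^esub> h (inv\<^bsub>G\<^esub> ?x) = h (G.commutator x g)"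
    using x g by (simp add: H.m_assoc H.inv_mult_group)
  finally show "G.commutator y g \<in> ?S"
    using y g G.commutator_in_commutator_subgroup[OF y(2) g] by auto
qed

lemma (in group_hom) iterated_commutator_powers:
  fixes m :: nat
  assumes X: "X \<lhd> G"
    and comm: "\<And>x y. x \<in> X \<Longrightarrow> y \<in> X \<Longrightarrow> h x \<otimes>\<^bsub>H\<^esub> h y = h y \<otimes>\<^bsub>H\<^esub> h x"
    and Y: "Y \<subseteq> {y \<in> carrier G. \<exists>x\<in>X. h y = h x [^]\<^bsub>H\<^esub> m}"
  shows "G.iterated_commutator Y n
    \<subseteq> {y \<in> carrier G. \<exists>x\<in>G.iterated_commutator X n. h y = h x [^]\<^bsub>H\<^esub> m}"
proof (induction n)
  case (Suc n)
  then show ?case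
    using commutator_subgroup_powers[OF G.iterated_commutator_normal[OF X] _ Suc]
      G.iterated_commutator_subset[OF X] comm by (simp add: subset_iff)
qed (use Y in simp)

text \<open>In G/W the image of N is abelian, and each block of m commutators with G extracts one
  more p-th power. After e blocks only p^e-th powers of elements of N remain, and these are trivial
  modulo W.\<close>

lemma (in group) iterated_commutator_subset_of_powers:
  fixes p :: nat
  assumes N: "N \<lhd> G" and W: "W \<lhd> G" and NW: "commutator_subgroup G N N \<subseteq> W"
    and powers: "\<And>y. y \<in> iterated_commutator N m
      \<Longrightarrow> \<exists>x\<in>N. \<exists>w\<in>commutator_subgroup G N N. y = w \<otimes> x [^] p"
    and e: "\<And>x. x \<in> N \<Longrightarrow> x [^] (p ^ e) \<in> W"
  shows "iterated_commutator N (m * e) \<subseteq> W"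
proof -
  let ?h = "\<lambda>x. W #> x"
  interpret W: normal W G by (rule W)
  interpret h: group_hom G "G Mod W" ?h
    using W.r_coset_hom_Mod W.factorgroup_is_group
    by (simp add: group_hom_def group_hom_axioms_def)
  have ker: "?h x = \<one>\<^bsub>G Mod W\<^esub> \<longleftrightarrow> x \<in> W" if "x \<in> carrier G" for x
    using that coset_join1[OF _ that W.subgroup_axioms] coset_join2[OF that W.subgroup_axioms]
      W.subset
    by (auto simp: FactGroup_def)
  note Nc = normal_subset[OF N]
  have comm: "?h x \<otimes>\<^bsub>G Mod W\<^esub> ?h y = ?h y \<otimes>\<^bsub>G Mod W\<^esub> ?h x" if xy: "x \<in> N" "y \<in> N" for x y
  proof -
    have c: "x \<in> carrier G" "y \<in> carrier G" using xy Nc by blast+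
    have "commutator x y \<in> W"
      by (rule subsetD[OF NW commutator_in_commutator_subgroup[OF xy]])
    then have "?h (commutator x y) = \<one>\<^bsub>G Mod W\<^esub>"
      using ker[of "commutator x y"] c by simp
    moreover have "?h (x \<otimes> y) = ?h (commutator x y \<otimes> (y \<otimes> x))"
      using c by (simp add: m_assoc)
    moreover have "?h (commutator x y \<otimes> (y \<otimes> x)) = ?h (commutator x y) \<otimes>\<^bsub>G Mod W\<^esub> ?h (y \<otimes> x)"
      by (rule h.hom_mult) (use c in simp_all)
    moreover have "?h (x \<otimes> y) = ?h x \<otimes>\<^bsub>G Mod W\<^esub> ?h y" "?h (y \<otimes> x) = ?h y \<otimes>\<^bsub>G Mod W\<^esub> ?h x"
      "?h (y \<otimes> x) \<in> carrier (G Mod W)"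
      using h.hom_mult[OF c] h.hom_mult[OF c(2,1)] h.hom_closed[of "y \<otimes> x"] c by blast+
    ultimately show ?thesis using h.H.l_one by metis
  qed
  have *: "iterated_commutator N (m * j)
    \<subseteq> {y \<in> carrier G. \<exists>x\<in>N. ?h y = ?h x [^]\<^bsub>G Mod W\<^esub> (p ^ j)}" for j
  proof (induction j)
    case 0
    have "?h x = ?h x [^]\<^bsub>G Mod W\<^esub> (1::nat)" if "x \<in> N" for x
      using h.hom_closed[OF subsetD[OF Nc that]]
      by (simp only: One_nat_def h.H.nat_pow_Suc h.H.nat_pow_0 h.H.l_one)
    then have "\<exists>x'\<in>N. ?h x = ?h x' [^]\<^bsub>G Mod W\<^esub> (1::nat)" if "x \<in> N" for x
      using that by blast
    then show ?case
      unfolding mult_0_right iterated_commutator.simps power_0 using Nc by blast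
  next
    case (Suc j)
    have "iterated_commutator N (m * Suc j) = iterated_commutator (iterated_commutator N (m * j)) m"
      by (simp add: iterated_commutator_add[symmetric] add.commute)
    \<comment> \<open>The p^j-th power passes through the next m commutators, so the base of the
      power now lies in [N, G, ..., G], where \<open>powers\<close> supplies another p-th power
      modulo [N, N].\<close>
    also have "\<dots> \<subseteq> {y \<in> carrier G. \<exists>x\<in>iterated_commutator N m. ?h y = ?h x [^]\<^bsub>G Mod W\<^esub> (p ^ j)}"
      by (intro h.iterated_commutator_powers N comm Suc)
    also have "\<dots> \<subseteq> {y \<in> carrier G. \<exists>x\<in>N. ?h y = ?h x [^]\<^bsub>G Mod W\<^esub> (p ^ Suc j)}"
    proof clarify
      fix y x assume y: "y \<in> carrier G" "x \<in> iterated_commutator N m"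
        "?h y = ?h x [^]\<^bsub>G Mod W\<^esub> (p ^ j)"
      from powers[OF y(2)] obtain x' w where x': "x' \<in> N" "w \<in> commutator_subgroup G N N"
        "x = w \<otimes> x' [^] p" by blast
      then have c: "w \<in> carrier G" "w \<in> W" "x' \<in> carrier G" using NW Nc W.subset by blast+
      then have "?h x = ?h x' [^]\<^bsub>G Mod W\<^esub> p"
        using ker[of w] x'(3) h.hom_mult[of w "x' [^] p"] h.hom_nat_pow[of x' p]
          h.H.l_one[OF h.hom_closed[of "x' [^] p"]] by (metis nat_pow_closed)
      then have "?h y = ?h x' [^]\<^bsub>G Mod W\<^esub> (p ^ Suc j)"
        using y c by (simp add: h.H.nat_pow_pow del: mult_FactGroup)
      then show "\<exists>x\<in>N. ?h y = ?h x [^]\<^bsub>G Mod W\<^esub> (p ^ Suc j)" using x' by blast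
    qed
    finally show ?case .
  qed
  show ?thesis
  proof
    fix y assume "y \<in> iterated_commutator N (m * e)"
    with * obtain x where y: "y \<in> carrier G" "x \<in> N" "?h y = ?h x [^]\<^bsub>G Mod W\<^esub> (p ^ e)" by blast
    then have "?h y = ?h (x [^] (p ^ e))" using Nc h.hom_nat_pow by auto
    then show "y \<in> W" using y ker e Nc by (metis nat_pow_closed subset_iff)
  qed
qed

text \<open>Hall's criterion with K the image of the p-series term of index k + 1. That term
  contains all p^k-th powers, so k blocks of m commutators suffice on the abelianization.\<close>

lemma (in group_hom) iterated_commutator_subset_lower_p_series:
  assumes N: "h ` carrier G \<lhd> H"
    and powers: "\<And>y. y \<in> H.iterated_commutator (h ` carrier G) m
      \<Longrightarrow> \<exists>x\<in>h ` carrier G. \<exists>w\<in>commutator_subgroup H (h ` carrier G) (h ` carrier G).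
            y = w \<otimes>\<^bsub>H\<^esub> x [^]\<^bsub>H\<^esub> p"
  shows "\<exists>n. H.iterated_commutator (h ` carrier G) n \<subseteq> h ` lower_p_series p G (Suc k)"
proof (rule H.iterated_commutator_subset_of_rel_lower_central[OF N])
  show "h ` lower_p_series p G (Suc k) \<lhd> H" by (rule image_lower_p_series_normal[OF N])
  show "H.rel_lower_central (h ` carrier G) k \<subseteq> h ` lower_p_series p G (Suc k)"
    by (rule rel_lower_central_subset_image_lower_p_series)
  fix W assume W: "W \<lhd> H" "commutator_subgroup H (h ` carrier G) (h ` carrier G) \<subseteq> W"
    and K: "h ` lower_p_series p G (Suc k) \<subseteq> W"
  have pow: "x [^]\<^bsub>H\<^esub> (p ^ k) \<in> W" if x: "x \<in> h ` carrier G" for x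
  proof -
    obtain a where "a \<in> carrier G" "x = h a" using x by blast
    then have "h (a [^]\<^bsub>G\<^esub> (p ^ k)) = x [^]\<^bsub>H\<^esub> (p ^ k)"
      using hom_nat_pow by blast
    moreover have "h (a [^]\<^bsub>G\<^esub> (p ^ k)) \<in> h ` lower_p_series p G (Suc k)"
      by (rule imageI[OF G.pow_in_lower_p_series[OF \<open>a \<in> carrier G\<close>]])
    ultimately have "x [^]\<^bsub>H\<^esub> (p ^ k) \<in> h ` lower_p_series p G (Suc k)" by (rule subst)
    then show ?thesis using K by (rule rev_subsetD)
  qed
  show "H.iterated_commutator (h ` carrier G) (m * k) \<subseteq> W"
    by (rule H.iterated_commutator_subset_of_powers[OF N W powers pow])
qed

section \<open>Group rings acting on abelian groups\<close>

lemma (in group_hom) hom_finprod: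
  assumes "comm_monoid G" "comm_monoid H" "f \<in> S \<rightarrow> carrier G"
  shows "h (finprod G f S) = finprod H (\<lambda>x. h (f x)) S"
  using assms(3)
proof (induction S rule: infinite_finite_induct)
  case (insert x S)
  then have f: "f \<in> S \<rightarrow> carrier G" "f x \<in> carrier G" by auto
  then have "(\<lambda>x. h (f x)) \<in> S \<rightarrow> carrier H" by (intro funcsetI hom_closed) (rule funcset_mem)
  with f insert show ?case
    using comm_monoid.finprod_insert[OF assms(1) insert.hyps f]
      comm_monoid.finprod_insert[OF assms(2) insert.hyps, of "\<lambda>x. h (f x)"]
      comm_monoid.finprod_closed[OF assms(1) f(1)] by simp
qed (simp_all add: comm_monoid.finprod_empty[OF assms(1)] comm_monoid.finprod_empty[OF assms(2)]
    comm_monoid.finprod_infinite[OF assms(1)] comm_monoid.finprod_infinite[OF assms(2)])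

locale group_action_by_hom = Q: comm_group Q + B: group B
  for Q :: "('x, 'k) monoid_scheme" (structure) and B :: "('b, 'm) monoid_scheme" +
  fixes act :: "'b \<Rightarrow> 'x \<Rightarrow> 'x"
  assumes act_hom: "b \<in> carrier B \<Longrightarrow> act b \<in> hom Q Q"
    and act_mult: "b \<in> carrier B \<Longrightarrow> c \<in> carrier B \<Longrightarrow> x \<in> carrier Q
      \<Longrightarrow> act (b \<otimes>\<^bsub>B\<^esub> c) x = act b (act c x)"
    and act_one: "x \<in> carrier Q \<Longrightarrow> act \<one>\<^bsub>B\<^esub> x = x"
begin

text \<open>This is the scalar multiplication of the group ring on Q, in the form used in the
  \<open>smult\<close> field of \<open>kernel_abelianization\<close>.\<close>

definition ring_act :: "('b \<Rightarrow>\<^sub>0 int) \<Rightarrow> 'x \<Rightarrow> 'x" where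
  "ring_act u x = finprod Q (\<lambda>b. act b x [^] Poly_Mapping.lookup u b) (Poly_Mapping.keys u)"

lemma act_closed [simp]: "b \<in> carrier B \<Longrightarrow> x \<in> carrier Q \<Longrightarrow> act b x \<in> carrier Q"
  using act_hom by (auto simp: hom_def)

lemma act_group_hom: "b \<in> carrier B \<Longrightarrow> group_hom Q Q (act b)"
  using act_hom by (simp add: group_hom_def group_hom_axioms_def)

text \<open>Elements of B outside the support contribute a power with exponent 0. Elements of the
  group ring with different supports can thus be expanded over a common index set.\<close>

lemma ring_act_superset:
  assumes "finite S" "Poly_Mapping.keys u \<subseteq> S" "S \<subseteq> carrier B" "x \<in> carrier Q"
  shows "ring_act u x = finprod Q (\<lambda>b. act b x [^] Poly_Mapping.lookup u b) S"
  unfolding ring_act_def using assms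
  by (intro Q.finprod_mono_neutral_cong_left) (auto simp: in_keys_iff subset_iff)

lemma ring_act_closed [simp]:
  "Poly_Mapping.keys u \<subseteq> carrier B \<Longrightarrow> x \<in> carrier Q \<Longrightarrow> ring_act u x \<in> carrier Q"
  unfolding ring_act_def by (intro Q.finprod_closed) auto

lemma ring_act_add:
  assumes "Poly_Mapping.keys u \<subseteq> carrier B" "Poly_Mapping.keys v \<subseteq> carrier B" "x \<in> carrier Q"
  shows "ring_act (u + v) x = ring_act u x \<otimes> ring_act v x"
proof -
  let ?S = "Poly_Mapping.keys u \<union> Poly_Mapping.keys v"
  have S: "finite ?S" "?S \<subseteq> carrier B" using assms by auto
  have "finprod Q (\<lambda>b. act b x [^] Poly_Mapping.lookup (u + v) b) ?S
    = finprod Q (\<lambda>b. act b x [^] Poly_Mapping.lookup u b \<otimes> act b x [^] Poly_Mapping.lookup v b) ?S"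
    using assms S by (intro Q.finprod_cong') (auto simp: lookup_add Q.int_pow_mult)
  also have "\<dots> = finprod Q (\<lambda>b. act b x [^] Poly_Mapping.lookup u b) ?S
      \<otimes> finprod Q (\<lambda>b. act b x [^] Poly_Mapping.lookup v b) ?S"
    using assms S by (intro Q.finprod_multf) auto
  finally show ?thesis
    using assms S by (simp add: ring_act_superset[of ?S] keys_add)
qed

lemma ring_act_single:
  assumes "b \<in> carrier B" "x \<in> carrier Q"
  shows "ring_act (Poly_Mapping.single b n) x = act b x [^] n"
  using assms by (subst ring_act_superset[of "{b}"]) auto

lemma ring_act_zero [simp]: "ring_act 0 x = \<one>"
  by (simp add: ring_act_def)

lemma ring_act_sum:
  assumes "finite S" "\<And>s. s \<in> S \<Longrightarrow> Poly_Mapping.keys (f s) \<subseteq> carrier B" "x \<in> carrier Q"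
  shows "ring_act (\<Sum>s\<in>S. f s) x = finprod Q (\<lambda>s. ring_act (f s) x) S"
  using assms
proof (induction S rule: finite_induct)
  case (insert s S)
  have "Poly_Mapping.keys (\<Sum>s\<in>S. f s) \<subseteq> carrier B"
    using insert.prems(1) keys_sum[of f S] by blast
  with insert show ?case
    by (simp add: ring_act_add Q.finprod_insert Pi_def)
qed simp

lemma group_ring_mult_keys:
  assumes "Poly_Mapping.keys u \<subseteq> carrier B" "Poly_Mapping.keys v \<subseteq> carrier B"
  shows "Poly_Mapping.keys (u \<otimes>\<^bsub>group_ring B\<^esub> v) \<subseteq> carrier B"
proof -
  have "Poly_Mapping.keys (u \<otimes>\<^bsub>group_ring B\<^esub> v)
    \<subseteq> (\<Union>b\<in>Poly_Mapping.keys u. \<Union>c\<in>Poly_Mapping.keys v. {b \<otimes>\<^bsub>B\<^esub> c})"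
    unfolding group_ring_def
    by (auto dest!: keys_sum[THEN subsetD] split: if_splits) blast
  then show ?thesis using assms by (force simp: subset_iff)
qed

text \<open>Both the action of b and raising to a fixed integer power are endomorphisms of the
  abelian group Q, so they can be moved out of the inner product.\<close>

lemma ring_act_mult:
  assumes u: "Poly_Mapping.keys u \<subseteq> carrier B" and v: "Poly_Mapping.keys v \<subseteq> carrier B"
    and x: "x \<in> carrier Q"
  shows "ring_act (u \<otimes>\<^bsub>group_ring B\<^esub> v) x = ring_act u (ring_act v x)"
proof -
  let ?s = "\<lambda>b c. Poly_Mapping.single (b \<otimes>\<^bsub>B\<^esub> c) (Poly_Mapping.lookup u b * Poly_Mapping.lookup v c)"
  have keys: "Poly_Mapping.keys (?s b c) \<subseteq> carrier B"
    if "b \<in> Poly_Mapping.keys u" "c \<in> Poly_Mapping.keys v" for b c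
    using that u v by (auto split: if_splits)
  have keys': "Poly_Mapping.keys (\<Sum>c\<in>Poly_Mapping.keys v. ?s b c) \<subseteq> carrier B"
    if "b \<in> Poly_Mapping.keys u" for b
    using keys[OF that] keys_sum[of "?s b" "Poly_Mapping.keys v"] by blast
  have inner: "ring_act (\<Sum>c\<in>Poly_Mapping.keys v. ?s b c) x
      = act b (ring_act v x) [^] Poly_Mapping.lookup u b" if b: "b \<in> Poly_Mapping.keys u" for b
  proof -
    have bB: "b \<in> carrier B" using b u by blast
    interpret b: group_hom Q Q "act b" using bB by (rule act_group_hom)
    interpret pow: group_hom Q Q "\<lambda>y. y [^] Poly_Mapping.lookup u b"
      by unfold_locales (auto simp: hom_def Q.int_pow_mult_distrib Q.m_comm)
    have "ring_act (\<Sum>c\<in>Poly_Mapping.keys v. ?s b c) x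
      = finprod Q (\<lambda>c. ring_act (?s b c) x) (Poly_Mapping.keys v)"
      using keys[OF b] x by (intro ring_act_sum) auto
    also have "\<dots> = finprod Q (\<lambda>c. act b (act c x [^] Poly_Mapping.lookup v c) [^] Poly_Mapping.lookup u b)
        (Poly_Mapping.keys v)"
      using v x bB
      by (intro Q.finprod_cong')
        (auto simp: ring_act_single act_mult b.hom_int_pow Q.int_pow_pow mult.commute subset_iff)
    also have "\<dots> = finprod Q (\<lambda>c. act b (act c x [^] Poly_Mapping.lookup v c))
        (Poly_Mapping.keys v) [^] Poly_Mapping.lookup u b"
      using v x bB
      by (intro pow.hom_finprod[symmetric] Q.comm_monoid_axioms) (auto simp: subset_iff)
    also have "finprod Q (\<lambda>c. act b (act c x [^] Poly_Mapping.lookup v c)) (Poly_Mapping.keys v)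
      = act b (ring_act v x)"
      unfolding ring_act_def using v x
      by (intro b.hom_finprod[symmetric] Q.comm_monoid_axioms) (auto simp: subset_iff)
    finally show ?thesis .
  qed
  have "ring_act (u \<otimes>\<^bsub>group_ring B\<^esub> v) x
    = finprod Q (\<lambda>b. ring_act (\<Sum>c\<in>Poly_Mapping.keys v. ?s b c) x) (Poly_Mapping.keys u)"
    using keys' x by (simp add: group_ring_def ring_act_sum)
  also have "\<dots> = ring_act u (ring_act v x)"
    unfolding ring_act_def[of u] using u v x inner
    by (intro Q.finprod_cong') (auto simp: subset_iff)
  finally show ?thesis .
qed

section \<open>Differences b - 1 and powers of the augmentation ideal\<close>

definition diff_act :: "'b \<Rightarrow> 'x \<Rightarrow> 'x" where
  "diff_act b x = act b x \<otimes> inv x"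

lemma diff_act_group_hom: "b \<in> carrier B \<Longrightarrow> group_hom Q Q (diff_act b)"
proof
  assume b: "b \<in> carrier B"
  interpret b: group_hom Q Q "act b" using b by (rule act_group_hom)
  show "diff_act b \<in> hom Q Q"
    unfolding diff_act_def hom_def using b by (auto simp: Q.inv_mult_group Q.m_ac)
qed

lemma ring_act_diff:
  assumes "b \<in> carrier B" "x \<in> carrier Q"
  shows "ring_act (Poly_Mapping.single b 1 - Poly_Mapping.single \<one>\<^bsub>B\<^esub> 1) x = diff_act b x"
proof -
  have eq: "Poly_Mapping.single b 1 - Poly_Mapping.single \<one>\<^bsub>B\<^esub> (1::int)
      = Poly_Mapping.single b 1 + Poly_Mapping.single \<one>\<^bsub>B\<^esub> (-1)"
    by (simp add: single_uminus)
  show ?thesis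
    unfolding eq using assms
    by (simp add: ring_act_add ring_act_single act_one diff_act_def Q.int_pow_neg)
qed

lemma single_diff_in_augmentation_ideal:
  assumes "b \<in> carrier B"
  shows "Poly_Mapping.single b 1 - Poly_Mapping.single \<one>\<^bsub>B\<^esub> 1 \<in> augmentation_ideal B"
proof -
  let ?u = "Poly_Mapping.single b 1 - Poly_Mapping.single \<one>\<^bsub>B\<^esub> (1::int)"
  have keys: "Poly_Mapping.keys ?u \<subseteq> {b, \<one>\<^bsub>B\<^esub>}"
    using keys_diff[of "Poly_Mapping.single b (1::int)" "Poly_Mapping.single \<one>\<^bsub>B\<^esub> 1"] by auto
  have "augmentation ?u = (\<Sum>c\<in>{b, \<one>\<^bsub>B\<^esub>}. Poly_Mapping.lookup ?u c)"
    unfolding augmentation_def using keys by (intro sum.mono_neutral_left) (auto simp: in_keys_iff)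
  also have "\<dots> = 0"
    by (cases "b = \<one>\<^bsub>B\<^esub>") (auto simp: lookup_minus lookup_single)
  finally show ?thesis
    using keys assms unfolding augmentation_ideal_def a_kernel_def'
    by (auto simp: group_ring_def)
qed

text \<open>Each difference b - 1 lies in the augmentation ideal, and \<open>ring_act\<close> turns
  products in the group ring into compositions.\<close>

lemma fold_diff_act_in_augmentation_power:
  assumes "set bs \<subseteq> carrier B"
  shows "\<exists>w\<in>augmentation_power B (length bs). Poly_Mapping.keys w \<subseteq> carrier B \<and>
    (\<forall>x\<in>carrier Q. ring_act w x = fold diff_act bs x)"
  using assms
proof (induction bs)
  case Nil
  \<comment> \<open>The zeroth power of an ideal is the whole group ring, hence contains its
    unit.\<close>
  have "Poly_Mapping.single \<one>\<^bsub>B\<^esub> 1 \<in> augmentation_power B 0"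
    by (simp add: augmentation_power_def nat_pow_def ideals_set_def group_ring_def)
  then show ?case
    by (intro bexI[of _ "Poly_Mapping.single \<one>\<^bsub>B\<^esub> 1"]) (auto simp: ring_act_single act_one)
next
  case (Cons b bs)
  then obtain w where w: "w \<in> augmentation_power B (length bs)" "Poly_Mapping.keys w \<subseteq> carrier B"
    "\<And>x. x \<in> carrier Q \<Longrightarrow> ring_act w x = fold diff_act bs x" by auto
  have b: "b \<in> carrier B" using Cons.prems by simp
  let ?d = "Poly_Mapping.single b 1 - Poly_Mapping.single \<one>\<^bsub>B\<^esub> (1::int)"
  have d: "?d \<in> augmentation_ideal B" by (rule single_diff_in_augmentation_ideal[OF b])
  then have dk: "Poly_Mapping.keys ?d \<subseteq> carrier B"
    by (simp add: augmentation_ideal_def a_kernel_def' group_ring_def)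
  interpret b: group_hom Q Q "diff_act b" using b by (rule diff_act_group_hom)
  \<comment> \<open>As \<open>fold\<close> applies the head of the list first, its factor b - 1
    stands on the right of the product.\<close>
  have "w \<otimes>\<^bsub>group_ring B\<^esub> ?d \<in> augmentation_power B (length (b # bs))"
    using ideal_prod.prod[OF w(1) d, of "group_ring B"]
    by (simp add: augmentation_power_def nat_pow_def ideals_set_def)
  moreover have "ring_act (w \<otimes>\<^bsub>group_ring B\<^esub> ?d) x = fold diff_act (b # bs) x"
    if "x \<in> carrier Q" for x
    using that w dk b by (simp add: ring_act_mult ring_act_diff del: One_nat_def)
  ultimately show ?case
    using group_ring_mult_keys[OF w(2) dk] by blast
qed

end

section \<open>Group extensions\<close>

locale extension = A: group A + i: group_hom A G i + q: group_hom G B q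
  for A :: "('a, 'k) monoid_scheme" and i :: "'a \<Rightarrow> 'g" and G :: "('g, 'l) monoid_scheme" (structure)
    and q :: "'g \<Rightarrow> 'b" and B :: "('b, 'm) monoid_scheme" +
  assumes inj_i: "inj_on i (carrier A)"
    and surj_q: "q ` carrier G = carrier B"
    and image_i: "i ` carrier A = kernel G B q"
begin

abbreviation D :: "'a set" where "D \<equiv> derived A (carrier A)"
abbreviation Q :: "'a set monoid" where "Q \<equiv> A Mod D"
abbreviation conj :: "'b \<Rightarrow> 'a set \<Rightarrow> 'a set" where "conj \<equiv> conj_action A i G q"

sublocale D: normal D A
  by (rule A.derived_self_is_normal)

sublocale Q: comm_group Q
  by (rule A.derived_quot_is_comm_group)

sublocale coset: group_hom A Q "\<lambda>x. D #>\<^bsub>A\<^esub> x"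
  using D.r_coset_hom_Mod by unfold_locales

lemma image_normal: "i ` carrier A \<lhd> G"
  unfolding image_i by (rule q.normal_kernel)

lemma D_eq: "D = commutator_subgroup A (carrier A) (carrier A)"
  by (simp add: derived_def commutator_subgroup_def)

lemma lower_central_2: "lower_central A 2 = D"
  by (simp add: D_eq numeral_2_eq_2)

lemma image_D: "i ` D = commutator_subgroup G (i ` carrier A) (i ` carrier A)"
  unfolding D_eq by (simp add: i.image_commutator_subgroup)

lemma image_D_normal: "i ` D \<lhd> G"
  unfolding image_D by (intro i.H.commutator_subgroup_normal image_normal)

lemma coset_eq_iff:
  assumes "x \<in> carrier A" "y \<in> carrier A"
  shows "D #>\<^bsub>A\<^esub> x = D #>\<^bsub>A\<^esub> y \<longleftrightarrow> y \<in> D #>\<^bsub>A\<^esub> x"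
  using A.repr_independence[OF _ assms(1) D.subgroup_axioms]
    A.repr_independenceD[OF D.subgroup_axioms assms(2)] by blast

section \<open>The action of B on the abelianized kernel\<close>

lemma conj_exists:
  assumes "g \<in> carrier G" "x \<in> carrier A"
  obtains x' where "x' \<in> carrier A" "i x' = g \<otimes> i x \<otimes> inv g"
  using normal.inv_op_closed2[OF image_normal assms(1), of "i x"] assms(2) by force

text \<open>The set of all conjugates is a single coset: D is invariant under conjugation by G, and
  two lifts of the same element of B differ by an element of A, which acts trivially on the abelian
  group A/D.\<close>

lemma conj_coset:
  assumes g: "g \<in> carrier G" and x: "x \<in> carrier A" and x': "x' \<in> carrier A"
    and eq: "i x' = g \<otimes> i x \<otimes> inv g"
  shows "conj (q g) (D #>\<^bsub>A\<^esub> x) = D #>\<^bsub>A\<^esub> x'"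
proof
  show "D #>\<^bsub>A\<^esub> x' \<subseteq> conj (q g) (D #>\<^bsub>A\<^esub> x)"
  proof
    fix y assume "y \<in> D #>\<^bsub>A\<^esub> x'"
    then obtain d where d: "d \<in> D" "y = d \<otimes>\<^bsub>A\<^esub> x'" by (auto simp: r_coset_def)
    then have dA: "d \<in> carrier A" using D.subset by blast
    \<comment> \<open>The factor d is moved through the conjugation, so that y becomes the conjugate
      of another representative of the coset of x.\<close>
    have "inv g \<otimes> i d \<otimes> g \<in> i ` D"
      using normal.inv_op_closed1[OF image_D_normal g] d by blast
    then obtain d' where d': "d' \<in> D" "i d' = inv g \<otimes> i d \<otimes> g" by force
    then have d'A: "d' \<in> carrier A" using D.subset by blast
    have "i y = g \<otimes> i (d' \<otimes>\<^bsub>A\<^esub> x) \<otimes> inv g"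
      using d d' dA d'A x x' g eq by (simp add: i.H.m_assoc)
    moreover have "d' \<otimes>\<^bsub>A\<^esub> x \<in> D #>\<^bsub>A\<^esub> x" using d' by (auto simp: r_coset_def)
    ultimately show "y \<in> conj (q g) (D #>\<^bsub>A\<^esub> x)"
      using g d dA x' unfolding conj_action_def by blast
  qed
  show "conj (q g) (D #>\<^bsub>A\<^esub> x) \<subseteq> D #>\<^bsub>A\<^esub> x'"
  proof
    fix y assume "y \<in> conj (q g) (D #>\<^bsub>A\<^esub> x)"
    then obtain h z where y: "y \<in> carrier A" and h: "h \<in> carrier G" "q h = q g"
      and z: "z \<in> D #>\<^bsub>A\<^esub> x" and iy: "i y = h \<otimes> i z \<otimes> inv h"
      unfolding conj_action_def by blast
    obtain d where d: "d \<in> D" "z = d \<otimes>\<^bsub>A\<^esub> x" using z by (auto simp: r_coset_def)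
    then have dA: "d \<in> carrier A" using D.subset by blast
    \<comment> \<open>The element a measures the difference between the lifts h and g.\<close>
    have "h \<otimes> inv g \<in> i ` carrier A"
      unfolding image_i kernel_def using h g by simp
    then obtain a where a: "a \<in> carrier A" "i a = h \<otimes> inv g" by force
    have "g \<otimes> i d \<otimes> inv g \<in> i ` D"
      using normal.inv_op_closed2[OF image_D_normal g] d by blast
    then obtain d' where d': "d' \<in> D" "i d' = g \<otimes> i d \<otimes> inv g" by force
    then have d'A: "d' \<in> carrier A" using D.subset by blast
    have "i y = i (a \<otimes>\<^bsub>A\<^esub> (d' \<otimes>\<^bsub>A\<^esub> x') \<otimes>\<^bsub>A\<^esub> inv\<^bsub>A\<^esub> a)"
      using d d' dA d'A x x' g eq a h iy by (simp add: i.H.m_assoc i.H.inv_mult_group)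
    then have "y = a \<otimes>\<^bsub>A\<^esub> (d' \<otimes>\<^bsub>A\<^esub> x') \<otimes>\<^bsub>A\<^esub> inv\<^bsub>A\<^esub> a"
      using inj_onD[OF inj_i] y a d'A x' by simp
    \<comment> \<open>In the commutative quotient the conjugation by a cancels and d'
      disappears.\<close>
    then have "D #>\<^bsub>A\<^esub> y = (D #>\<^bsub>A\<^esub> a) \<otimes>\<^bsub>Q\<^esub> ((D #>\<^bsub>A\<^esub> d') \<otimes>\<^bsub>Q\<^esub> (D #>\<^bsub>A\<^esub> x')) \<otimes>\<^bsub>Q\<^esub> inv\<^bsub>Q\<^esub> (D #>\<^bsub>A\<^esub> a)"
      using a d'A x' by (simp del: mult_FactGroup)
    also have "D #>\<^bsub>A\<^esub> d' = \<one>\<^bsub>Q\<^esub>"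
      using A.coset_join2[OF d'A D.subgroup_axioms d'(1)] by simp
    also have "(D #>\<^bsub>A\<^esub> a) \<otimes>\<^bsub>Q\<^esub> (\<one>\<^bsub>Q\<^esub> \<otimes>\<^bsub>Q\<^esub> (D #>\<^bsub>A\<^esub> x')) \<otimes>\<^bsub>Q\<^esub> inv\<^bsub>Q\<^esub> (D #>\<^bsub>A\<^esub> a) = D #>\<^bsub>A\<^esub> x'"
      using coset.hom_closed[OF a(1)] coset.hom_closed[OF x']
      by (simp only: Q.l_one Q.m_comm[of "D #>\<^bsub>A\<^esub> a" "D #>\<^bsub>A\<^esub> x'"] Q.m_assoc Q.inv_closed Q.r_inv Q.r_one)
    finally show "y \<in> D #>\<^bsub>A\<^esub> x'" using coset_eq_iff[OF x' y] by simp
  qed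
qed

lemma Q_cases:
  assumes "X \<in> carrier Q"
  obtains x where "x \<in> carrier A" "X = D #>\<^bsub>A\<^esub> x"
  using assms unfolding carrier_FactGroup by blast

lemma B_cases:
  assumes "b \<in> carrier B"
  obtains g where "g \<in> carrier G" "b = q g"
  using assms surj_q by blast

text \<open>All axioms are checked on lifts to G and representatives in A, where they become
  identities between conjugates; \<open>conj_coset\<close> makes the choices irrelevant.\<close>

sublocale conj: group_action_by_hom Q B conj
proof unfold_locales
  fix b assume b: "b \<in> carrier B"
  obtain g where g: "g \<in> carrier G" "b = q g" using b by (rule B_cases)
  have ex: "\<exists>x'\<in>carrier A. i x' = g \<otimes> i x \<otimes> inv g \<and> conj b (D #>\<^bsub>A\<^esub> x) = D #>\<^bsub>A\<^esub> x'"
    if x: "x \<in> carrier A" for x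
    using conj_exists[OF g(1) x] conj_coset[OF g(1) x] g(2) by metis
  show "conj b \<in> hom Q Q"
    unfolding hom_def
  proof (intro CollectI conjI ballI funcsetI)
    fix X assume "X \<in> carrier Q"
    then obtain x where x: "x \<in> carrier A" "X = D #>\<^bsub>A\<^esub> x" by (rule Q_cases)
    then show "conj b X \<in> carrier Q" using ex coset.hom_closed by metis
    fix Y assume "Y \<in> carrier Q"
    then obtain y where y: "y \<in> carrier A" "Y = D #>\<^bsub>A\<^esub> y" by (rule Q_cases)
    obtain x' where x': "x' \<in> carrier A" "i x' = g \<otimes> i x \<otimes> inv g" "conj b X = D #>\<^bsub>A\<^esub> x'"
      using ex x by blast
    obtain y' where y': "y' \<in> carrier A" "i y' = g \<otimes> i y \<otimes> inv g" "conj b Y = D #>\<^bsub>A\<^esub> y'"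
      using ex y by blast
    have "i (x' \<otimes>\<^bsub>A\<^esub> y') = g \<otimes> i (x \<otimes>\<^bsub>A\<^esub> y) \<otimes> inv g"
      using x y x' y' g by (simp add: i.H.m_assoc)
    then have "conj b (D #>\<^bsub>A\<^esub> (x \<otimes>\<^bsub>A\<^esub> y)) = D #>\<^bsub>A\<^esub> (x' \<otimes>\<^bsub>A\<^esub> y')"
      unfolding g(2) using A.m_closed x y x' y' by (intro conj_coset[OF g(1)]) simp_all
    then show "conj b (X \<otimes>\<^bsub>Q\<^esub> Y) = conj b X \<otimes>\<^bsub>Q\<^esub> conj b Y"
      unfolding x(2) y(2) coset.hom_mult[OF x(1) y(1)] coset.hom_mult[OF x'(1) y'(1)]
      unfolding x(2)[symmetric] y(2)[symmetric] x'(3) y'(3) .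
  qed
  fix c X assume c: "c \<in> carrier B" and "X \<in> carrier Q"
  then obtain x where x: "x \<in> carrier A" "X = D #>\<^bsub>A\<^esub> x" using Q_cases by blast
  obtain h where h: "h \<in> carrier G" "c = q h" using c by (rule B_cases)
  obtain x' where x': "x' \<in> carrier A" "i x' = h \<otimes> i x \<otimes> inv h"
    using conj_exists[OF h(1) x(1)] .
  obtain x'' where x'': "x'' \<in> carrier A" "i x'' = g \<otimes> i x' \<otimes> inv g"
    using conj_exists[OF g(1) x'(1)] .
  have "i x'' = (g \<otimes> h) \<otimes> i x \<otimes> inv (g \<otimes> h)"
    using x x' x'' g h by (simp add: i.H.m_assoc i.H.inv_mult_group)
  then show "conj (b \<otimes>\<^bsub>B\<^esub> c) X = conj b (conj c X)"
    using conj_coset[OF g(1) x'(1) x''] conj_coset[OF h(1) x(1) x']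
      conj_coset[of "g \<otimes> h" x x''] g h x x'' by simp
next
  fix X assume "X \<in> carrier Q"
  then obtain x where x: "x \<in> carrier A" "X = D #>\<^bsub>A\<^esub> x" by (rule Q_cases)
  then show "conj \<one>\<^bsub>B\<^esub> X = X"
    using conj_coset[of \<one> x x] by simp
qed

section \<open>Commutators with G as differences in the module\<close>

text \<open>These are the values of n-fold products of differences b - 1. They belong to the n-th
  power of the augmentation ideal applied to Q, and this inclusion is all that is established
  below.\<close>

definition diff_images :: "nat \<Rightarrow> 'a set set" where
  "diff_images n = {fold conj.diff_act bs X |bs X. set bs \<subseteq> carrier B \<and> length bs = n \<and> X \<in> carrier Q}"

lemma diff_images_subset: "diff_images n \<subseteq> carrier Q"
proof -
  have "fold conj.diff_act bs X \<in> carrier Q" if "set bs \<subseteq> carrier B" "X \<in> carrier Q" for bs X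
    using that
    by (induction bs arbitrary: X)
      (auto simp: group_hom.hom_closed[OF conj.diff_act_group_hom] simp del: mult_FactGroup)
  then show ?thesis unfolding diff_images_def by blast
qed

lemma diff_act_diff_images:
  assumes b: "b \<in> carrier B"
  shows "conj.diff_act b ` generate Q (diff_images n) \<subseteq> generate Q (diff_images (Suc n))"
proof -
  interpret b: group_hom Q Q "conj.diff_act b" using b by (rule conj.diff_act_group_hom)
  have "conj.diff_act b ` diff_images n \<subseteq> diff_images (Suc n)"
  proof
    fix Y assume "Y \<in> conj.diff_act b ` diff_images n"
    then obtain bs X where *: "set bs \<subseteq> carrier B" "length bs = n" "X \<in> carrier Q"
      "Y = conj.diff_act b (fold conj.diff_act bs X)"
      unfolding diff_images_def by blast
    \<comment> \<open>The last element of a list acts last under \<open>fold\<close>, so the new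
      difference is appended at the end.\<close>
    then have "set (bs @ [b]) \<subseteq> carrier B" "length (bs @ [b]) = Suc n"
      "Y = fold conj.diff_act (bs @ [b]) X" using b by auto
    with * show "Y \<in> diff_images (Suc n)" unfolding diff_images_def by blast
  qed
  then show ?thesis
    unfolding b.generate_img[OF diff_images_subset, symmetric] by (rule Q.mono_generate)
qed

text \<open>For a in A and g in G, the class of [a, g] is the inverse of (q g - 1) applied to the
  class of a. Each further commutator with G therefore amounts to one further difference.\<close>

lemma iterated_commutator_diff_images:
  "i.H.iterated_commutator (i ` carrier A) n
    \<subseteq> i ` {a \<in> carrier A. D #>\<^bsub>A\<^esub> a \<in> generate Q (diff_images n)}"
proof (induction n)
  case 0
  have "carrier Q \<subseteq> diff_images 0" unfolding diff_images_def by force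
  then have "D #>\<^bsub>A\<^esub> a \<in> generate Q (diff_images 0)" if "a \<in> carrier A" for a
    using coset.hom_closed[OF that] by (auto intro: generate.incl)
  then show ?case by auto
next
  case (Suc n)
  let ?E = "\<lambda>n. generate Q (diff_images n)"
  let ?T = "\<lambda>n. {a \<in> carrier A. D #>\<^bsub>A\<^esub> a \<in> ?E n}"
  have E: "subgroup (?E n) Q" for n
    by (rule Q.generate_is_subgroup[OF diff_images_subset])
  have T: "subgroup (?T (Suc n)) A"
  proof (rule A.subgroupI)
    have "\<one>\<^bsub>A\<^esub> \<in> ?T (Suc n)"
      using subgroup.one_closed[OF E[of "Suc n"]] D.subset by simp
    then show "?T (Suc n) \<noteq> {}" by blast
    show "inv\<^bsub>A\<^esub> a \<in> ?T (Suc n)" if "a \<in> ?T (Suc n)" for a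
      using that subgroup.m_inv_closed[OF E[of "Suc n"]] by simp
    show "a \<otimes>\<^bsub>A\<^esub> b \<in> ?T (Suc n)" if "a \<in> ?T (Suc n)" "b \<in> ?T (Suc n)" for a b
      using that subgroup.m_closed[OF E[of "Suc n"]] by (simp del: mult_FactGroup)
  qed auto
  have "commutator_subgroup G (i.H.iterated_commutator (i ` carrier A) n) (carrier G)
    \<subseteq> i ` ?T (Suc n)"
  proof (rule i.H.commutator_subgroup_incl)
    show "subgroup (i ` ?T (Suc n)) G" by (rule i.subgroup_img_is_subgroup[OF T])
    fix y g assume "y \<in> i.H.iterated_commutator (i ` carrier A) n" and g: "g \<in> carrier G"
    then obtain a where a: "a \<in> carrier A" "D #>\<^bsub>A\<^esub> a \<in> ?E n" "y = i a" using Suc by blast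
    obtain a' where a': "a' \<in> carrier A" "i a' = g \<otimes> i a \<otimes> inv g"
      using conj_exists[OF g a(1)] .
    note closed = coset.hom_closed[OF a(1)] coset.hom_closed[OF a'(1)]
    have "i.H.commutator y g = i (a \<otimes>\<^bsub>A\<^esub> inv\<^bsub>A\<^esub> a')"
      using a a' g by (simp add: i.H.m_assoc i.H.inv_mult_group)
    moreover have "conj.diff_act (q g) (D #>\<^bsub>A\<^esub> a) \<in> ?E (Suc n)"
      using diff_act_diff_images[of "q g" n] g a(2) by auto
    then have "inv\<^bsub>Q\<^esub> (conj.diff_act (q g) (D #>\<^bsub>A\<^esub> a)) \<in> ?E (Suc n)"
      by (rule subgroup.m_inv_closed[OF E])
    \<comment> \<open>The inverse appears because [a, g] carries the conjugate of a with exponent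
      -1, whereas \<open>diff_act\<close> carries it with exponent 1.\<close>
    moreover have "inv\<^bsub>Q\<^esub> (conj.diff_act (q g) (D #>\<^bsub>A\<^esub> a)) = D #>\<^bsub>A\<^esub> (a \<otimes>\<^bsub>A\<^esub> inv\<^bsub>A\<^esub> a')"
      unfolding conj.diff_act_def conj_coset[OF g a(1) a'] using closed a a'
      by (simp add: Q.inv_mult_group del: mult_FactGroup)
    ultimately have "i.H.commutator y g = i (a \<otimes>\<^bsub>A\<^esub> inv\<^bsub>A\<^esub> a')"
      "a \<otimes>\<^bsub>A\<^esub> inv\<^bsub>A\<^esub> a' \<in> ?T (Suc n)"
      using a a' by (simp_all del: mult_FactGroup coset.hom_mult)
    then show "i.H.commutator y g \<in> i ` ?T (Suc n)" by blast
  qed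
  then show ?case by simp
qed

lemma diff_images_subset_ideal_smult:
  "diff_images n \<subseteq> ideal_smult (kernel_abelianization A i G q) (augmentation_power B n)"
proof
  fix Y assume "Y \<in> diff_images n"
  then obtain bs X where *: "set bs \<subseteq> carrier B" "length bs = n" "X \<in> carrier Q"
    "Y = fold conj.diff_act bs X"
    unfolding diff_images_def by blast
  from conj.fold_diff_act_in_augmentation_power[OF *(1)] *
  obtain w where "w \<in> augmentation_power B n" "Y = conj.ring_act w X" by auto
  then have "Y \<in> (\<Union>r\<in>augmentation_power B n. \<Union>x\<in>carrier (kernel_abelianization A i G q).
      {r \<odot>\<^bsub>kernel_abelianization A i G q\<^esub> x})"
    using *(3)
    by (auto simp: kernel_abelianization_def Let_def lower_central_2 conj.ring_act_def
        simp del: mult_FactGroup)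
  then show "Y \<in> ideal_smult (kernel_abelianization A i G q) (augmentation_power B n)"
    unfolding ideal_smult_def by (rule generate.incl)
qed

lemma nat_multiples_eq:
  "nat_multiples (kernel_abelianization A i G q) p = (\<lambda>X. X [^]\<^bsub>Q\<^esub> p) ` carrier Q"
  unfolding nat_multiples_def
  by (intro image_cong)
    (simp_all add: kernel_abelianization_def Let_def lower_central_2 add_pow_def nat_pow_def)

text \<open>The p-th power map is an endomorphism of the abelian group Q, so its image is already a
  subgroup. An inclusion of generators therefore suffices below.\<close>

lemma subgroup_powers: "subgroup ((\<lambda>X. X [^]\<^bsub>Q\<^esub> (p::nat)) ` carrier Q) Q"
proof -
  interpret pow: group_hom Q Q "\<lambda>X. X [^]\<^bsub>Q\<^esub> p"
    by unfold_locales (auto simp: hom_def Q.pow_mult_distrib Q.m_comm simp del: mult_FactGroup)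
  show ?thesis by (rule pow.img_is_subgroup)
qed

text \<open>This translates the module hypothesis into group terms: the coset of a is the p-th power
  of the coset of some x, hence a = d x^p with d in D.\<close>

lemma iterated_commutator_powers:
  fixes p :: nat
  assumes "ideal_smult (kernel_abelianization A i G q) (augmentation_power B n)
      \<subseteq> nat_multiples (kernel_abelianization A i G q) p"
    and "y \<in> i.H.iterated_commutator (i ` carrier A) n"
  shows "\<exists>x\<in>i ` carrier A. \<exists>w\<in>commutator_subgroup G (i ` carrier A) (i ` carrier A).
    y = w \<otimes> x [^] p"
proof -
  obtain a where a: "a \<in> carrier A" "D #>\<^bsub>A\<^esub> a \<in> generate Q (diff_images n)" "y = i a"
    using iterated_commutator_diff_images assms(2) by blast
  have "generate Q (diff_images n) \<subseteq> (\<lambda>X. X [^]\<^bsub>Q\<^esub> p) ` carrier Q"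
    using diff_images_subset_ideal_smult[of n] assms(1) nat_multiples_eq[of p]
    by (intro Q.generate_subgroup_incl subgroup_powers) blast
  then obtain X where "X \<in> carrier Q" "D #>\<^bsub>A\<^esub> a = X [^]\<^bsub>Q\<^esub> p" using a(2) by blast
  moreover from this(1) obtain x where x: "x \<in> carrier A" "X = D #>\<^bsub>A\<^esub> x" by (rule Q_cases)
  ultimately have "D #>\<^bsub>A\<^esub> (x [^]\<^bsub>A\<^esub> p) = D #>\<^bsub>A\<^esub> a"
    by (simp add: D.FactGroup_pow)
  then have "a \<in> D #>\<^bsub>A\<^esub> (x [^]\<^bsub>A\<^esub> p)"
    using coset_eq_iff[of "x [^]\<^bsub>A\<^esub> p" a] x a by simp
  then obtain d where d: "d \<in> D" "a = d \<otimes>\<^bsub>A\<^esub> x [^]\<^bsub>A\<^esub> p" by (auto simp: r_coset_def)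
  then have "d \<in> carrier A" using D.subset by blast
  then have "y = i d \<otimes> i x [^] p" using a d x by (simp add: i.hom_nat_pow)
  then show ?thesis using d x unfolding image_D[symmetric] by blast
qed

section \<open>From the kernel to the lower central series of G\<close>

text \<open>The surjection q maps each term of the lower central series of G onto the corresponding
  term for B.\<close>

lemma lower_central_subset_kernel:
  assumes "lower_central B (Suc s) = {\<one>\<^bsub>B\<^esub>}"
  shows "lower_central G (Suc s) \<subseteq> i ` carrier A"
proof -
  have sub: "lower_central G (Suc n) \<subseteq> carrier G" for n
    using i.H.normal_subset[OF i.H.iterated_commutator_normal[OF i.H.normal_self]]
    by (simp add: i.H.iterated_commutator_carrier[symmetric])
  have "q ` lower_central G (Suc n) = lower_central B (Suc n)" for n
  proof (induction n)
    case (Suc n)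
    then show ?case using q.image_commutator_subgroup[OF sub order_refl] surj_q by simp
  qed (simp add: surj_q)
  then have "q ` lower_central G (Suc s) = {\<one>\<^bsub>B\<^esub>}" using assms by metis
  then show ?thesis unfolding image_i kernel_def using sub[of s] by blast
qed

theorem residually_nilpotent:
  assumes p_nil: "residually_p_nilpotent p A"
    and nil: "lower_central B (Suc s) = {\<one>\<^bsub>B\<^esub>}"
    and incl: "ideal_smult (kernel_abelianization A i G q) (augmentation_power B N)
      \<subseteq> nat_multiples (kernel_abelianization A i G q) p"
  shows "residually_nilpotent G"
proof -
  let ?R = "\<Inter>k\<in>{1..}. lower_central G k"
  \<comment> \<open>The number n of commutators depends on k; the intersection over all terms of the
    lower central series of G absorbs this dependence.\<close>
  have step: "?R \<subseteq> i ` lower_p_series p A (Suc k)" for k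
  proof -
    obtain n where n: "i.H.iterated_commutator (i ` carrier A) n \<subseteq> i ` lower_p_series p A (Suc k)"
      using i.iterated_commutator_subset_lower_p_series[OF image_normal
          iterated_commutator_powers[OF incl]] by blast
    \<comment> \<open>The first s commutators lead into A, and the remaining n lead from A into the
      chosen term of its p-series.\<close>
    have "lower_central G (Suc (s + n)) = i.H.iterated_commutator (lower_central G (Suc s)) n"
      by (simp only: i.H.iterated_commutator_carrier[symmetric] i.H.iterated_commutator_add)
    also have "\<dots> \<subseteq> i.H.iterated_commutator (i ` carrier A) n"
      by (rule i.H.iterated_commutator_mono[OF lower_central_subset_kernel[OF nil]])
    finally have "lower_central G (Suc (s + n)) \<subseteq> i ` lower_p_series p A (Suc k)" using n by simp
    moreover have "?R \<subseteq> lower_central G (Suc (s + n))" by (intro INF_lower) simp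
    ultimately show ?thesis by blast
  qed
  have "x = \<one>" if x: "x \<in> ?R" for x
  proof -
    \<comment> \<open>The case k = 0 concerns the first term of the p-series, which is A
      itself.\<close>
    have "x \<in> i ` carrier A" using step[of 0] x by auto
    then obtain a where a: "a \<in> carrier A" "x = i a" by blast
    have "a \<in> lower_p_series p A k" if "k \<ge> 1" for k
    proof -
      obtain k' where k: "k = Suc k'" using \<open>k \<ge> 1\<close> by (cases k) auto
      have "i a \<in> i ` lower_p_series p A k" using step[of k'] x a k by blast
      then show ?thesis
        by (simp only: inj_on_image_mem_iff[OF inj_i a(1) A.normal_subset[OF A.lower_p_series_normal]])
    qed
    then have "a = \<one>\<^bsub>A\<^esub>"
      using p_nil unfolding residually_p_nilpotent_def by blast
    then show ?thesis using a by simp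
  qed
  moreover have "\<one> \<in> lower_central G k" if "k \<ge> 1" for k
  proof -
    obtain k' where k: "k = Suc k'" using \<open>k \<ge> 1\<close> by (cases k) auto
    show ?thesis
      unfolding k i.H.iterated_commutator_carrier[symmetric]
      using normal_imp_subgroup[OF i.H.iterated_commutator_normal[OF i.H.normal_self]]
        subgroup.one_closed by blast
  qed
  ultimately show ?thesis unfolding residually_nilpotent_def by blast
qed

end

theorem theorem3p4:
  fixes p :: nat
    and A :: "'a monoid" and G :: "'g monoid" and B :: "'b monoid"
    and i :: "'a \<Rightarrow> 'g" and q :: "'g \<Rightarrow> 'b"
  assumes "prime p"
    and "short_exact A i G q B"
    and "residually_p_nilpotent p A"
    and "\<exists>s\<ge>2. lower_central B s = {\<one>\<^bsub>B\<^esub>}"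
    and "\<exists>N\<ge>1. ideal_smult (kernel_abelianization A i G q) (augmentation_power B N)
                 \<subseteq> nat_multiples (kernel_abelianization A i G q) p"
  shows "residually_nilpotent G"
proof -
  interpret extension A i G q B
    using assms(2)
    by (auto simp: short_exact_def mon_def epi_def extension_def extension_axioms_def
        group_hom_def group_hom_axioms_def)
  obtain s where "s \<ge> 2" "lower_central B s = {\<one>\<^bsub>B\<^esub>}" using assms(4) by blast
  \<comment> \<open>Writing s as a successor matches the shift between \<open>lower_central\<close>,
    which starts at 1, and the number of commutators taken.\<close>
  then obtain s' where "lower_central B (Suc s') = {\<one>\<^bsub>B\<^esub>}" by (cases s) auto
  with assms(3,5) show ?thesis using residually_nilpotent by blast
qed

end
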